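(* Let $n,k\ge0$ be integers. The irreducible representations of the algebra $(\mathcal{D}_n^{(k)},* )$ are of dimension $1$, and (up to isomorphism) they are parametrized by the partitions of $n$ with at most $k$ parts equal to $1$.
   Context: $\mathbf{Sym}=\bigoplus_{n\ge0}\mathbf{Sym}_n$ (noncommutative symmetric functions, over $\mathbb{C}$) is the free associative unital algebra on generators $S_1,S_2,\dots$ with $\deg S_n=n$, $S_0=1$. For a composition $I=(i_1,\dots,i_r)$ of $n$, $S^I=S_{i_1}\cdots S_{i_r}$; these form a basis of $\mathbf{Sym}_n$. The internal product $*$ is the bilinear associative product on $\mathbf{Sym}$ with $F*G=0$ if $F,G$ are homogeneous of different degrees, and, for compositions $I,J$ of $n$, $S^I*S^J=\sum_M S^M$, sum over all nonnegative integer matrices $M$ with row sums $I$ and column sums $J$, where $S^M$ is the product of the $S_{m_{ij}}$ read row by row (left to right, top to bottom). Set $S_n^\sharp=\sum_{i=0}^n(-1)^i\frac{S_1^i}{i!}S_{n-i}$, $\mathcal{D}_n^{(0)}=\{F*S_n^\sharp : F\in\mathbf{Sym}_n\}$ and $\mathcal{D}_n^{(k)}=\bigoplus_{j=0}^{\min(k,n)}S_j\,\mathcal{D}^{(0)}_{n-j}$ (ordinary products). $(\mathcal{D}_n^{(k)},* )$ is a finite-dimensional unital algebra, with unit $\sum_{i=0}^{\min(k,n)}\frac{S_1^i}{i!}S_{n-i}^\sharp$; representations are unital. *)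

theory Defs
  imports
    Complex_Main
    "HOL-Library.Multiset"
    "HOL-Library.Poly_Mapping"
begin

section \<open>Noncommutative symmetric functions\<close>

text \<open>
  Compositions (of arbitrary nonnegative integers) form the free monoid on the positive integers
  under concatenation. \<open>Sym\<close> is the monoid algebra of this monoid over the complex numbers,
  i.e. the free associative unital algebra on \<open>S_1, S_2, \<dots>\<close>: the basis element at a
  composition \<open>I\<close> is \<open>S^I\<close>, and \<open>lookup F I\<close> is the coefficient of \<open>S^I\<close> in \<open>F\<close>. The ring
  structure on \<open>sym\<close> is the convolution product of \<^theory>\<open>HOL-Library.Poly_Mapping\<close>, which here
  is the ordinary (noncommutative) product; the monoid operation on compositions is written
  additively only because that theory requires it.
\<close>

typedef composition = "{I :: nat list. 0 \<notin> set I}"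
  morphisms parts Composition
  by (rule exI [of _ "[]"]) simp

setup_lifting type_definition_composition

instantiation composition :: monoid_add
begin

lift_definition zero_composition :: composition is "[]"
  by simp

lift_definition plus_composition :: "composition \<Rightarrow> composition \<Rightarrow> composition" is "(@)"
  by simp

instance
  by standard (transfer, simp)+

end

type_synonym sym = "composition \<Rightarrow>\<^sub>0 complex"

definition smult_sym :: "complex \<Rightarrow> sym \<Rightarrow> sym"
  where "smult_sym c F = Poly_Mapping.map (\<lambda>a. c * a) F"

definition S :: "nat \<Rightarrow> sym"
  where "S m = (if m = 0 then 1 else Poly_Mapping.single (Composition [m]) 1)"

definition Sym_hom :: "nat \<Rightarrow> sym set"
  where "Sym_hom n = {F. \<forall>I \<in> Poly_Mapping.keys F. sum_list (parts I) = n}"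


section \<open>The internal product\<close>

text \<open>A matrix is the list of its rows; \<open>concat\<close> reads it row by row.\<close>

definition int_matrices :: "nat list \<Rightarrow> nat list \<Rightarrow> nat list list set"
  where "int_matrices I J =
    {M. length M = length I \<and> (\<forall>r \<in> set M. length r = length J) \<and>
        (\<forall>i < length I. (\<Sum>j < length J. M ! i ! j) = I ! i) \<and>
        (\<forall>j < length J. (\<Sum>i < length I. M ! i ! j) = J ! j)}"

definition S_matrix :: "nat list list \<Rightarrow> sym"
  where "S_matrix M = prod_list (map S (concat M))"

definition iprod_basis :: "composition \<Rightarrow> composition \<Rightarrow> sym"
  where "iprod_basis I J =
    (if sum_list (parts I) = sum_list (parts J)
     then \<Sum>M \<in> int_matrices (parts I) (parts J). S_matrix M else 0)"

definition iprod :: "sym \<Rightarrow> sym \<Rightarrow> sym"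
  where "iprod F G =
    (\<Sum>I \<in> Poly_Mapping.keys F. \<Sum>J \<in> Poly_Mapping.keys G.
       smult_sym (Poly_Mapping.lookup F I * Poly_Mapping.lookup G J) (iprod_basis I J))"


section \<open>The algebras \<open>D_n^(k)\<close>\<close>

definition S_sharp :: "nat \<Rightarrow> sym"
  where "S_sharp n = (\<Sum>i\<le>n. smult_sym ((-1) ^ i / fact i) (S 1 ^ i * S (n - i)))"

definition D0 :: "nat \<Rightarrow> sym set"
  where "D0 n = {iprod F (S_sharp n) | F. F \<in> Sym_hom n}"

text \<open>The sum defining \<open>D_n^(k)\<close> is direct; as a set it is the set of all sums of its summands.\<close>

definition D :: "nat \<Rightarrow> nat \<Rightarrow> sym set"
  where "D n k = {\<Sum>j\<le>min k n. S j * G j | G. \<forall>j\<le>min k n. G j \<in> D0 (n - j)}"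

definition D_unit :: "nat \<Rightarrow> nat \<Rightarrow> sym"
  where "D_unit n k = (\<Sum>i\<le>min k n. smult_sym (1 / fact i) (S 1 ^ i * S_sharp (n - i)))"


section \<open>Representations\<close>

text \<open>
  A representation lives on a subspace \<open>V\<close> of an ambient complex vector space with underlying
  type \<open>'v\<close> and scalar multiplication \<open>scale\<close>; no finiteness of the dimension is imposed. The
  action \<open>\<rho>\<close> matters only on elements of \<open>D n k\<close> and vectors of \<open>V\<close>. Every complex vector space
  occurs as an ambient space (with \<open>V = UNIV\<close> allowed), and any two occur as subspaces of a
  common ambient space, namely their product. The ambient space has to be nonzero to contain any irreducible
  representation at all.
\<close>

definition representation ::
  "(complex \<Rightarrow> 'v \<Rightarrow> 'v::ab_group_add) \<Rightarrow> nat \<Rightarrow> nat \<Rightarrow> 'v set \<Rightarrow> (sym \<Rightarrow> 'v \<Rightarrow> 'v) \<Rightarrow> bool"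
  where "representation scale n k V \<rho> \<longleftrightarrow>
    module.subspace scale V \<and>
    (\<forall>F \<in> D n k. \<forall>v \<in> V. \<rho> F v \<in> V) \<and>
    (\<forall>F \<in> D n k. \<forall>v \<in> V. \<forall>w \<in> V. \<rho> F (v + w) = \<rho> F v + \<rho> F w) \<and>
    (\<forall>F \<in> D n k. \<forall>c. \<forall>v \<in> V. \<rho> F (scale c v) = scale c (\<rho> F v)) \<and>
    (\<forall>F \<in> D n k. \<forall>G \<in> D n k. \<forall>v \<in> V. \<rho> (F + G) v = \<rho> F v + \<rho> G v) \<and>
    (\<forall>c. \<forall>F \<in> D n k. \<forall>v \<in> V. \<rho> (smult_sym c F) v = scale c (\<rho> F v)) \<and>
    (\<forall>F \<in> D n k. \<forall>G \<in> D n k. \<forall>v \<in> V. \<rho> (iprod F G) v = \<rho> F (\<rho> G v)) \<and>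
    (\<forall>v \<in> V. \<rho> (D_unit n k) v = v)"

definition irreducible_rep ::
  "(complex \<Rightarrow> 'v \<Rightarrow> 'v::ab_group_add) \<Rightarrow> nat \<Rightarrow> nat \<Rightarrow> 'v set \<Rightarrow> (sym \<Rightarrow> 'v \<Rightarrow> 'v) \<Rightarrow> bool"
  where "irreducible_rep scale n k V \<rho> \<longleftrightarrow>
    representation scale n k V \<rho> \<and> V \<noteq> {0} \<and>
    (\<forall>U. module.subspace scale U \<and> U \<subseteq> V \<and> (\<forall>F \<in> D n k. \<forall>u \<in> U. \<rho> F u \<in> U)
          \<longrightarrow> U = {0} \<or> U = V)"

definition rep_isomorphic ::
  "(complex \<Rightarrow> 'v \<Rightarrow> 'v::ab_group_add) \<Rightarrow> nat \<Rightarrow> nat \<Rightarrow>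
    'v set \<times> (sym \<Rightarrow> 'v \<Rightarrow> 'v) \<Rightarrow> 'v set \<times> (sym \<Rightarrow> 'v \<Rightarrow> 'v) \<Rightarrow> bool"
  where "rep_isomorphic scale n k = (\<lambda>(V, \<rho>) (W, \<sigma>).
    \<exists>\<phi>. bij_betw \<phi> V W \<and>
      (\<forall>v \<in> V. \<forall>w \<in> V. \<phi> (v + w) = \<phi> v + \<phi> w) \<and>
      (\<forall>c. \<forall>v \<in> V. \<phi> (scale c v) = scale c (\<phi> v)) \<and>
      (\<forall>F \<in> D n k. \<forall>v \<in> V. \<phi> (\<rho> F v) = \<sigma> F (\<phi> v)))"

definition irreps ::
  "(complex \<Rightarrow> 'v \<Rightarrow> 'v::ab_group_add) \<Rightarrow> nat \<Rightarrow> nat \<Rightarrow> ('v set \<times> (sym \<Rightarrow> 'v \<Rightarrow> 'v)) set"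
  where "irreps scale n k = {(V, \<rho>). irreducible_rep scale n k V \<rho>}"

definition irrep_iso ::
  "(complex \<Rightarrow> 'v \<Rightarrow> 'v::ab_group_add) \<Rightarrow> nat \<Rightarrow> nat \<Rightarrow>
    (('v set \<times> (sym \<Rightarrow> 'v \<Rightarrow> 'v)) \<times> ('v set \<times> (sym \<Rightarrow> 'v \<Rightarrow> 'v))) set"
  where "irrep_iso scale n k =
    {(R, T). R \<in> irreps scale n k \<and> T \<in> irreps scale n k \<and> rep_isomorphic scale n k R T}"


section \<open>Partitions\<close>

definition partitions_few_ones :: "nat \<Rightarrow> nat \<Rightarrow> nat multiset set"
  where "partitions_few_ones n k = {p. 0 \<notin># p \<and> sum_mset p = n \<and> count p 1 \<le> k}"

end

theory Submission
  imports Defs "HOL-Computational_Algebra.Formal_Power_Series"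
begin

text \<open>
  Both \<open>\<sigma>(x) = \<Sum>\<^sub>n x^n S_n\<close> and \<open>\<sigma>\<^sup>\<sharp>(x) = exp (- x S_1) \<sigma>(x)\<close> are grouplike, hence so is
  \<open>g = \<sigma>(x_0) \<sigma>\<^sup>\<sharp>(x_1) \<cdots> \<sigma>\<^sup>\<sharp>(x_r)\<close>, and right internal multiplication by \<open>g_n\<close> is the restriction to
  degree \<open>n\<close> of the algebra endomorphism \<open>S_m \<mapsto> g_m\<close> of the ordinary product. Interpolation in the
  \<open>x_i\<close> shows that the elements \<open>g_n\<close> span a space containing \<open>D_n^(k)\<close>, so most identities need to be
  checked only for \<open>g_n\<close>; closure of \<open>D_n^(k)\<close> under the internal product follows from
  \<open>S_m^\<sharp> * g_m = (\<sigma>\<^sup>\<sharp>(x_0) \<sigma>\<^sup>\<sharp>(x_1) \<cdots> \<sigma>\<^sup>\<sharp>(x_r))_m\<close>. Right internal multiplication is triangular with respect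
  to the length of compositions: \<open>S^I * G\<close> is \<open>\<chi>_I(G) S^I\<close> plus terms with more parts, where \<open>\<chi>_I\<close> is a
  character that depends only on the partition underlying \<open>I\<close>. Therefore every nonzero representation
  contains a common eigenvector on which \<open>D_n^(k)\<close> acts through some \<open>\<chi>_I\<close>. On \<open>D_n^(k)\<close> the character
  \<open>\<chi>_I\<close> is zero if \<open>I\<close> has more than \<open>k\<close> parts \<open>1\<close>, and the other ones are pairwise distinct, as
  their values at the products of the \<open>S_1, S_2^\<sharp>, S_3^\<sharp>, \<dots>\<close> show.
\<close>

section \<open>Linear algebra over the basis of compositions\<close>

lemma smult_sym_conv_mult: "smult_sym c F = Poly_Mapping.single 0 c * F"
  by (simp add: smult_sym_def mult_map_scale_conv_mult)

lemma lookup_smult_sym [simp]: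
  "Poly_Mapping.lookup (smult_sym c F) I = c * Poly_Mapping.lookup F I"
  by (simp add: smult_sym_def Poly_Mapping.map.rep_eq when_def)

interpretation sym: vector_space smult_sym
  by unfold_locales (auto intro!: poly_mapping_eqI simp: lookup_add algebra_simps)

lemma sym_expansion:
  "F = (\<Sum>I\<in>Poly_Mapping.keys F. Poly_Mapping.single I (Poly_Mapping.lookup F I))"
  by (intro poly_mapping_eqI) (simp add: lookup_sum lookup_single when_def in_keys_iff)

text \<open>Constants are central although the product is not commutative: the empty composition is
  neutral on both sides.\<close>

lemma single_zero_commute: "Poly_Mapping.single 0 c * F = F * Poly_Mapping.single (0 :: composition) (c :: complex)"
  by (subst (1 2) sym_expansion [of F]) (simp add: sum_distrib_left sum_distrib_right mult_single mult.commute)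

lemma smult_sym_mult_left [simp]: "smult_sym c F * G = smult_sym c (F * G)"
  by (simp add: smult_sym_conv_mult mult.assoc)

lemma smult_sym_mult_right [simp]: "F * smult_sym c G = smult_sym c (F * G)"
  by (simp add: smult_sym_conv_mult) (metis mult.assoc single_zero_commute)

abbreviation lin_op :: "(sym \<Rightarrow> sym) \<Rightarrow> bool"
  where "lin_op \<equiv> Vector_Spaces.linear smult_sym smult_sym"

lemma lin_opI:
  assumes "\<And>F G. f (F + G) = f F + f G" "\<And>c F. f (smult_sym c F) = smult_sym c (f F)"
  shows "lin_op f"
  using assms by unfold_locales auto

lemma lin_opD:
  assumes "lin_op f"
  shows "f (F + G) = f F + f G" "f (smult_sym c F) = smult_sym c (f F)" "f 0 = 0"
    "f (sum g X) = (\<Sum>x\<in>X. f (g x))" "f (F - G) = f F - f G"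
proof -
  interpret Vector_Spaces.linear smult_sym smult_sym f by fact
  show "f (F + G) = f F + f G" "f (smult_sym c F) = smult_sym c (f F)" "f 0 = 0"
    "f (sum g X) = (\<Sum>x\<in>X. f (g x))" "f (F - G) = f F - f G"
    by (rule add scale zero sum diff)+
qed

lemma lin_op_mult_left: "lin_op (\<lambda>F. H * F)"
  by (rule lin_opI) (simp_all add: distrib_left)

lemma lin_op_mult_right: "lin_op (\<lambda>F. F * H)"
  by (rule lin_opI) (simp_all add: distrib_right)

lemma lin_op_compose: "lin_op f \<Longrightarrow> lin_op g \<Longrightarrow> lin_op (\<lambda>F. f (g F))"
  by (rule lin_opI) (simp_all add: lin_opD)

definition lin_ext :: "(composition \<Rightarrow> sym) \<Rightarrow> sym \<Rightarrow> sym"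
  where "lin_ext f F = (\<Sum>I\<in>Poly_Mapping.keys F. smult_sym (Poly_Mapping.lookup F I) (f I))"

lemma lin_ext_superset:
  assumes "finite X" "Poly_Mapping.keys F \<subseteq> X"
  shows "lin_ext f F = (\<Sum>I\<in>X. smult_sym (Poly_Mapping.lookup F I) (f I))"
  unfolding lin_ext_def using assms by (intro sum.mono_neutral_left) (auto simp: in_keys_iff)

lemma lin_op_lin_ext: "lin_op (lin_ext f)"
proof (rule lin_opI)
  fix F G :: sym and c
  let ?X = "Poly_Mapping.keys F \<union> Poly_Mapping.keys G"
  have "Poly_Mapping.keys (F + G) \<subseteq> ?X"
    by (rule keys_add)
  then show "lin_ext f (F + G) = lin_ext f F + lin_ext f G"
    by (simp add: lin_ext_superset [of ?X] lookup_add sym.scale_left_distrib sum.distrib)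
  have "Poly_Mapping.keys (smult_sym c F) \<subseteq> Poly_Mapping.keys F"
    by (auto simp: in_keys_iff)
  then show "lin_ext f (smult_sym c F) = smult_sym c (lin_ext f F)"
    by (simp add: lin_ext_superset [of "Poly_Mapping.keys F"] sym.scale_sum_right)
qed

lemma lin_ext_single: "lin_ext f (Poly_Mapping.single I c) = smult_sym c (f I)"
  by (simp add: lin_ext_def)

lemma lin_ext_add_fun: "lin_ext (\<lambda>I. f I + g I) F = lin_ext f F + lin_ext g F"
  by (simp add: lin_ext_def sym.scale_right_distrib sum.distrib)

lemma lin_ext_smult_fun: "lin_ext (\<lambda>I. smult_sym c (f I)) F = smult_sym c (lin_ext f F)"
  by (simp add: lin_ext_def sym.scale_sum_right mult.commute)

lemma lin_ext_sum_fun: "lin_ext (\<lambda>I. \<Sum>x\<in>X. f x I) F = (\<Sum>x\<in>X. lin_ext (f x) F)"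
  by (simp add: lin_ext_def sym.scale_sum_right) (rule sum.swap)

text \<open>The list may contain zeros, which contribute the factor \<open>S 0 = 1\<close>. Rows of
  matrices and differences of such rows are lists of this kind.\<close>

definition Sb :: "nat list \<Rightarrow> sym"
  where "Sb L = prod_list (map S L)"

lemma Sb_simps [simp]: "Sb [] = 1" "Sb (j # J) = S j * Sb J" "Sb (J @ K) = Sb J * Sb K"
  by (simp_all add: Sb_def)

lemma S_0 [simp]: "S 0 = 1"
  by (simp add: S_def)

lemma zero_notin_parts [simp]: "0 \<notin> set (parts I)"
  using parts [of I] by auto

lemma composition_Cons_split:
  assumes "0 \<notin> set (j # J)"
  shows "Composition (j # J) = Composition [j] + Composition J"
  using assms by (simp add: eq_onp_same_args plus_composition.abs_eq)

lemma Sb_positive: "0 \<notin> set J \<Longrightarrow> Sb J = Poly_Mapping.single (Composition J) 1"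
proof (induction J)
  case Nil
  then show ?case by (simp flip: zero_composition.abs_eq)
next
  case (Cons j J)
  then show ?case
    using composition_Cons_split [of j J] by (simp add: S_def mult_single)
qed

lemma single_eq_Sb: "Poly_Mapping.single I c = smult_sym c (Sb (parts I))"
  by (simp add: Sb_positive parts_inverse smult_sym_conv_mult mult_single)

lemma sym_expansion_Sb:
  "F = (\<Sum>I\<in>Poly_Mapping.keys F. smult_sym (Poly_Mapping.lookup F I) (Sb (parts I)))"
  using sym_expansion [of F] by (simp add: single_eq_Sb)

lemma Sb_drop_zeros: "Sb (filter ((<) 0) J) = Sb J"
  by (induction J) auto

lemma lin_ext_Sb: "0 \<notin> set J \<Longrightarrow> lin_ext f (Sb J) = f (Composition J)"
  by (simp add: Sb_positive lin_ext_single)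

text \<open>A recursion on lists that ignores zero entries extends linearly to \<open>sym\<close>,
  and the recursion then remains available at \<open>Sb J\<close> for lists with zeros. The
  coproduct, the substitutions and the derivations are all introduced in this way.\<close>

lemma lin_ext_Sb_list:
  assumes "\<And>J. f (filter ((<) 0) J) = f J"
  shows "lin_ext (\<lambda>I. f (parts I)) (Sb J) = f J"
proof -
  have "lin_ext (\<lambda>I. f (parts I)) (Sb (filter ((<) 0) J)) = f (filter ((<) 0) J)"
    by (subst lin_ext_Sb) (auto simp: Composition_inverse)
  then show ?thesis by (simp only: Sb_drop_zeros assms)
qed

lemma lin_op_eqI:
  assumes "lin_op f" "lin_op g" "\<And>J. 0 \<notin> set J \<Longrightarrow> f (Sb J) = g (Sb J)"
  shows "f F = g F"
  by (subst (1 2) sym_expansion_Sb [of F]) (simp add: lin_opD assms)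

section \<open>Homogeneous elements\<close>

lemma subspace_keys: "sym.subspace {F. Poly_Mapping.keys F \<subseteq> X}"
proof -
  have "Poly_Mapping.keys (F + G) \<subseteq> X"
    if "Poly_Mapping.keys F \<subseteq> X" "Poly_Mapping.keys G \<subseteq> X" for F G :: sym
    using keys_add [of F G] that by blast
  then show ?thesis
    by (auto simp: sym.subspace_def in_keys_iff)
qed

lemma Sym_hom_eq: "Sym_hom n = {F. Poly_Mapping.keys F \<subseteq> {I. sum_list (parts I) = n}}"
  by (auto simp: Sym_hom_def)

lemma subspace_Sym_hom: "sym.subspace (Sym_hom n)"
  by (simp add: Sym_hom_eq subspace_keys)

lemma Sym_hom_mult:
  assumes "F \<in> Sym_hom a" "G \<in> Sym_hom b"
  shows "F * G \<in> Sym_hom (a + b)"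
  using assms keys_mult [of F G] by (fastforce simp: Sym_hom_def plus_composition.rep_eq)

lemma one_in_Sym_hom [simp]: "1 \<in> Sym_hom 0"
  by (simp add: Sym_hom_def zero_composition.rep_eq flip: single_one)

lemma Sb_in_Sym_hom: "Sb J \<in> Sym_hom (sum_list J)"
proof (induction J)
  case (Cons j J)
  have "S j \<in> Sym_hom j"
    by (auto simp: Sym_hom_def S_def Composition_inverse zero_composition.rep_eq simp flip: single_one)
  then show ?case using Cons by (simp add: Sym_hom_mult)
qed simp

lemma S_in_Sym_hom: "S j \<in> Sym_hom j"
  using Sb_in_Sym_hom [of "[j]"] by simp

lemma Sym_hom_induct [consumes 1, case_names subspace basis]:
  assumes "F \<in> Sym_hom n" "sym.subspace {F. P F}"
    "\<And>J. 0 \<notin> set J \<Longrightarrow> sum_list J = n \<Longrightarrow> P (Sb J)"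
  shows "P F"
proof -
  have "(\<Sum>I\<in>Poly_Mapping.keys F. smult_sym (Poly_Mapping.lookup F I) (Sb (parts I))) \<in> {F. P F}"
    using assms by (intro sym.subspace_sum sym.subspace_scale) (auto simp: Sym_hom_def)
  then show ?thesis using sym_expansion_Sb [of F] by simp
qed

lemma Sym_hom_0: "F \<in> Sym_hom 0 \<Longrightarrow> F = smult_sym (Poly_Mapping.lookup F 0) 1"
proof (induction rule: Sym_hom_induct)
  case subspace
  show ?case
    unfolding sym.subspace_def
    by simp (metis lookup_add lookup_smult_sym sym.scale_left_distrib sym.scale_scale)
next
  case (basis J)
  then have "J = []" by (cases J) auto
  then show ?case by simp
qed

lemma lookup_0_Sym_hom: "F \<in> Sym_hom n \<Longrightarrow> n > 0 \<Longrightarrow> Poly_Mapping.lookup F 0 = 0"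
  unfolding Sym_hom_def
  by (rule ccontr) (auto dest!: bspec [of _ _ "0 :: composition"] simp: zero_composition.rep_eq in_keys_iff)

section \<open>The coproduct and the splitting of the internal product by rows\<close>

definition bilin_op :: "(sym \<Rightarrow> sym \<Rightarrow> sym) \<Rightarrow> bool"
  where "bilin_op \<Psi> \<longleftrightarrow> (\<forall>A. lin_op (\<Psi> A)) \<and> (\<forall>B. lin_op (\<lambda>A. \<Psi> A B))"

lemma bilin_opD:
  assumes "bilin_op \<Psi>"
  shows "lin_op (\<Psi> A)" "lin_op (\<lambda>A. \<Psi> A B)"
  using assms by (auto simp: bilin_op_def)

lemma bilin_op_mult:
  assumes "bilin_op \<Psi>"
  shows "bilin_op (\<lambda>A B. \<Psi> (F * A) (G * B))"
  unfolding bilin_op_def using assms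
  by (auto intro: lin_op_compose bilin_opD lin_op_mult_left
      lin_op_compose [of "\<lambda>A. \<Psi> A B" "\<lambda>A. F * A" for B])

text \<open>\<open>cop \<Psi> G\<close> is the image of the coproduct of \<open>G\<close> under the map on the tensor square that the
  bilinear map \<open>\<Psi>\<close> induces; the tensor square itself is not constructed.\<close>

primrec cop_list :: "nat list \<Rightarrow> (sym \<Rightarrow> sym \<Rightarrow> sym) \<Rightarrow> sym"
  where
    "cop_list [] \<Psi> = \<Psi> 1 1"
  | "cop_list (j # J) \<Psi> = (\<Sum>a\<le>j. cop_list J (\<lambda>A B. \<Psi> (S a * A) (S (j - a) * B)))"

definition cop :: "(sym \<Rightarrow> sym \<Rightarrow> sym) \<Rightarrow> sym \<Rightarrow> sym"
  where "cop \<Psi> = lin_ext (\<lambda>I. cop_list (parts I) \<Psi>)"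

lemma lin_op_cop: "lin_op (cop \<Psi>)"
  by (simp add: cop_def lin_op_lin_ext)

lemma cop_Sb: "cop \<Psi> (Sb J) = cop_list J \<Psi>"
proof -
  have "cop_list (filter ((<) 0) J) \<Psi> = cop_list J \<Psi>" for J
    by (induction J arbitrary: \<Psi>) auto
  then show ?thesis
    unfolding cop_def by (rule lin_ext_Sb_list)
qed

lemma cop_1: "cop \<Psi> 1 = \<Psi> 1 1"
  using cop_Sb [of \<Psi> "[]"] by simp

lemma cop_list_sum: "cop_list J (\<lambda>A B. \<Sum>x\<in>X. \<Psi> x A B) = (\<Sum>x\<in>X. cop_list J (\<Psi> x))"
proof (induction J arbitrary: \<Psi>)
  case (Cons j J)
  then show ?case by simp (rule sum.swap)
qed simp

lemma cop_list_smult: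
  "cop_list J (\<lambda>A B. smult_sym c (\<Psi> A B)) = smult_sym c (cop_list J \<Psi>)"
proof (induction J arbitrary: \<Psi>)
  case (Cons j J)
  then show ?case by (simp add: sym.scale_sum_right)
qed simp

lemma cop_sum_fun: "cop (\<lambda>A B. \<Sum>x\<in>X. \<Psi> x A B) G = (\<Sum>x\<in>X. cop (\<Psi> x) G)"
  by (simp add: cop_def cop_list_sum lin_ext_sum_fun)

lemma cop_smult_fun: "cop (\<lambda>A B. smult_sym c (\<Psi> A B)) G = smult_sym c (cop \<Psi> G)"
  by (simp add: cop_def cop_list_smult lin_ext_smult_fun)

text \<open>The coproduct is multiplicative and splits \<open>S j\<close> into the tensors of
  \<open>S a\<close> and \<open>S (j - a)\<close>. This is the model for the last clause of
  \<open>grouplike\<close>.\<close>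

lemma cop_S_mult:
  "cop \<Psi> (S j * G) = (\<Sum>a\<le>j. cop (\<lambda>A B. \<Psi> (S a * A) (S (j - a) * B)) G)"
proof (rule lin_op_eqI [where f = "\<lambda>G. cop \<Psi> (S j * G)"])
  show "lin_op (\<lambda>G. cop \<Psi> (S j * G))"
    by (rule lin_op_compose [OF lin_op_cop lin_op_mult_left])
  show "lin_op (\<lambda>G. \<Sum>a\<le>j. cop (\<lambda>A B. \<Psi> (S a * A) (S (j - a) * B)) G)"
    by (rule lin_opI) (simp_all add: lin_opD [OF lin_op_cop] sum.distrib sym.scale_sum_right)
  show "cop \<Psi> (S j * Sb J) = (\<Sum>a\<le>j. cop (\<lambda>A B. \<Psi> (S a * A) (S (j - a) * B)) (Sb J))" for J
    using cop_Sb [of \<Psi> "j # J"] by (simp add: cop_Sb)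
qed

section \<open>Row-by-row evaluation of the internal product\<close>

definition hom_part :: "nat \<Rightarrow> sym \<Rightarrow> sym"
  where "hom_part i = lin_ext (\<lambda>I. if sum_list (parts I) = i then Sb (parts I) else 0)"

lemma lin_op_hom_part: "lin_op (hom_part i)"
  by (simp add: hom_part_def lin_op_lin_ext)

lemma hom_part_Sym_hom:
  assumes "A \<in> Sym_hom a"
  shows "hom_part i A = (if a = i then A else 0)"
  using assms
proof (induction rule: Sym_hom_induct)
  case subspace
  show ?case
    by (auto simp: sym.subspace_def lin_opD [OF lin_op_hom_part])
next
  case (basis J)
  then show ?case by (auto simp: hom_part_def lin_ext_Sb Composition_inverse)
qed

text \<open>\<open>S_left I G\<close> is \<open>S^I * G\<close>, computed one row of the matrices at a time.\<close>

primrec S_left :: "nat list \<Rightarrow> sym \<Rightarrow> sym"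
  where
    "S_left [] G = smult_sym (Poly_Mapping.lookup G 0) 1"
  | "S_left (i # I) G = cop (\<lambda>A B. hom_part i A * S_left I B) G"

lemma lin_op_S_left: "lin_op (S_left I)"
proof (cases I)
  case Nil
  show ?thesis
    unfolding Nil by (rule lin_opI) (simp_all add: lookup_add sym.scale_left_distrib)
next
  case (Cons i I')
  have "S_left (i # I') = cop (\<lambda>A B. hom_part i A * S_left I' B)"
    by (rule ext) simp
  then show ?thesis
    by (simp add: Cons lin_op_cop)
qed

lemma bilin_op_row: "bilin_op (\<lambda>A B. hom_part i A * S_left I B)"
  unfolding bilin_op_def
  by (auto intro!: lin_op_compose [OF lin_op_mult_left lin_op_S_left]
      lin_op_compose [OF lin_op_mult_right lin_op_hom_part])

section \<open>Matrices with prescribed row and column sums, decomposed by their first row\<close>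

lemma mem_listset_atMost: "r \<in> listset (map atMost J) \<longleftrightarrow> list_all2 (\<le>) r J"
  by (induction J arbitrary: r) (auto simp: set_Cons_def list_all2_Cons2)

lemma finite_listset_atMost: "finite (listset (map atMost (J :: nat list)))"
proof (induction J)
  case (Cons j J)
  have "listset (map atMost (j # J)) = (\<lambda>(a, r). a # r) ` ({..j} \<times> listset (map atMost J))"
    by (auto simp: set_Cons_def)
  then show ?case using Cons by simp
qed simp

lemma sum_listset_Cons:
  "(\<Sum>r\<in>listset (map atMost (j # J)). f r) =
   (\<Sum>a\<le>(j :: nat). \<Sum>r\<in>listset (map atMost J). f (a # r))"
proof -
  have "listset (map atMost (j # J)) = (\<lambda>(a, r). a # r) ` ({..j} \<times> listset (map atMost J))"
    by (auto simp: set_Cons_def)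
  moreover have "inj_on (\<lambda>(a, r). a # r) ({..j} \<times> listset (map atMost J))"
    by (auto simp: inj_on_def)
  ultimately show ?thesis
    by (simp add: sum.reindex sum.cartesian_product case_prod_unfold)
qed

lemma cop_list_eq_sum:
  "cop_list J \<Psi> = (\<Sum>r\<in>listset (map atMost J). \<Psi> (Sb r) (Sb (map2 (-) J r)))"
proof (induction J arbitrary: \<Psi>)
  case (Cons j J)
  show ?case
    by (simp only: sum_listset_Cons) (simp add: Cons)
qed simp

text \<open>Removing the first row \<open>r\<close> leaves a matrix whose column sums are the
  entries of \<open>J\<close> diminished by those of \<open>r\<close>. As \<open>r\<close> is
  bounded entrywise by \<open>J\<close>, the subtraction of naturals is exact.\<close>

lemma int_matrices_Cons:
  "int_matrices (i # I) J = (\<lambda>(r, M). r # M) `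
     (SIGMA r:{r \<in> listset (map atMost J). sum_list r = i}. int_matrices I (map2 (-) J r))"
  (is "?L = ?R")
proof (intro set_eqI iffI)
  fix N
  assume N: "N \<in> ?L"
  then obtain r M where NrM: "N = r # M"
    by (auto simp: int_matrices_def length_Suc_conv)
  have len: "length M = length I" "\<forall>r\<in>set (r # M). length r = length J"
    and row: "\<forall>k<Suc (length I). (\<Sum>j<length J. (r # M) ! k ! j) = (i # I) ! k"
    and col': "\<forall>j<length J. (\<Sum>k<Suc (length I). (r # M) ! k ! j) = J ! j"
    using N unfolding NrM int_matrices_def by auto
  have r: "length r = length J" "(\<Sum>j<length J. r ! j) = i"
    using len row by auto
  have M: "length M = length I" "\<forall>r\<in>set M. length r = length J"
    "\<forall>k<length I. (\<Sum>j<length J. M ! k ! j) = I ! k"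
    using len row by auto
  have col: "\<forall>j<length J. r ! j + (\<Sum>k<length I. M ! k ! j) = J ! j"
    using col' by (simp add: sum.lessThan_Suc_shift del: sum.lessThan_Suc)
  have le: "r ! j \<le> J ! j \<and> (\<Sum>i<length I. M ! i ! j) = J ! j - r ! j" if "j < length J" for j
    using col that by (metis add_diff_cancel_left' le_add1)
  have "r \<in> listset (map atMost J)" "sum_list r = i"
    using r le by (auto simp: mem_listset_atMost list_all2_conv_all_nth sum_list_sum_nth atLeast0LessThan)
  moreover have "M \<in> int_matrices I (map2 (-) J r)"
    using r M le by (auto simp: int_matrices_def)
  ultimately show "N \<in> ?R"
    unfolding NrM by force
next
  fix N
  assume "N \<in> ?R"
  then obtain r M where NrM: "N = r # M" and r: "r \<in> listset (map atMost J)" "sum_list r = i"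
    and M: "M \<in> int_matrices I (map2 (-) J r)"
    by auto
  have r': "length r = length J" "\<And>j. j < length J \<Longrightarrow> r ! j \<le> J ! j" "(\<Sum>j<length J. r ! j) = i"
    using r by (auto simp: mem_listset_atMost list_all2_conv_all_nth sum_list_sum_nth atLeast0LessThan)
  have col: "r ! j + (\<Sum>i<length I. M ! i ! j) = J ! j" if "j < length J" for j
    using M r' that by (auto simp: int_matrices_def)
  have row: "(\<Sum>j<length J. N ! k ! j) = (i # I) ! k" if "k < length (i # I)" for k
    using that M r' unfolding NrM by (cases k) (auto simp: int_matrices_def)
  show "N \<in> ?L"
    using M r' col row unfolding int_matrices_def
    by (auto simp: NrM sum.lessThan_Suc_shift simp del: sum.lessThan_Suc)
qed

lemma finite_int_matrices: "finite (int_matrices I J)"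
proof (induction I arbitrary: J)
  case Nil
  have "int_matrices [] J \<subseteq> {[]}"
    by (auto simp: int_matrices_def)
  then show ?case
    by (rule finite_subset) simp
next
  case (Cons i I)
  then show ?case
    by (auto simp: int_matrices_Cons finite_listset_atMost intro!: finite_imageI finite_SigmaI)
qed

lemma lookup_Sb_0: "Poly_Mapping.lookup (Sb J) 0 = (if \<forall>j\<in>set J. j = 0 then 1 else 0)"
proof -
  let ?K = "filter ((<) 0) J"
  have "Sb J = Poly_Mapping.single (Composition ?K) 1"
    using Sb_positive [of ?K] by (simp add: Sb_drop_zeros)
  moreover have "Composition ?K = 0 \<longleftrightarrow> ?K = []"
    by (simp add: zero_composition_def Composition_inject)
  ultimately show ?thesis
    by (auto simp: lookup_single filter_empty_conv)
qed

lemma S_matrix_Cons: "S_matrix (r # M) = Sb r * S_matrix M"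
  by (simp add: S_matrix_def Sb_def)

text \<open>The coproduct of \<open>Sb J\<close> runs over all ways to write \<open>J\<close> as a
  row plus a remainder; \<open>hom_part i\<close> keeps the rows with sum \<open>i\<close>, and the
  remainder is the vector of column sums for the other rows.\<close>

lemma S_left_Sb: "S_left I (Sb J) = (\<Sum>M\<in>int_matrices I J. S_matrix M)"
proof (induction I arbitrary: J)
  case Nil
  have "int_matrices [] J = (if \<forall>j\<in>set J. j = 0 then {[]} else {})"
    by (auto simp: int_matrices_def all_set_conv_all_nth)
  then show ?case
    by (auto simp: lookup_Sb_0 S_matrix_def)
next
  case (Cons i I)
  let ?X = "listset (map atMost J)" and ?Y = "\<lambda>r. int_matrices I (map2 (-) J r)"
  have "S_left (i # I) (Sb J) = (\<Sum>r\<in>?X. hom_part i (Sb r) * S_left I (Sb (map2 (-) J r)))"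
    by (simp add: cop_Sb cop_list_eq_sum)
  also have "\<dots> = (\<Sum>r\<in>?X. if sum_list r = i then Sb r * (\<Sum>M\<in>?Y r. S_matrix M) else 0)"
    by (rule sum.cong) (auto simp: Cons hom_part_Sym_hom [OF Sb_in_Sym_hom])
  also have "\<dots> = (\<Sum>r\<in>{r \<in> ?X. sum_list r = i}. \<Sum>M\<in>?Y r. S_matrix (r # M))"
    unfolding sum.inter_filter [OF finite_listset_atMost, symmetric]
    by (simp add: sum_distrib_left S_matrix_Cons)
  also have "\<dots> = (\<Sum>N\<in>int_matrices (i # I) J. S_matrix N)"
    unfolding int_matrices_Cons
    by (subst sum.reindex)
      (auto simp: inj_on_def finite_listset_atMost finite_int_matrices sum.Sigma case_prod_unfold)
  finally show ?case .
qed

text \<open>The total of all entries, computed by rows and by columns, would have two values. So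
  \<open>S_left\<close> also gives the value 0 of \<open>iprod_basis\<close> in different
  degrees.\<close>

lemma int_matrices_eq_empty:
  assumes "sum_list I \<noteq> sum_list J"
  shows "int_matrices I J = {}"
proof -
  have False if M: "M \<in> int_matrices I J" for M
  proof -
    have "sum_list I = (\<Sum>i<length I. \<Sum>j<length J. M ! i ! j)"
      using M by (simp add: int_matrices_def sum_list_sum_nth atLeast0LessThan)
    also have "\<dots> = (\<Sum>j<length J. \<Sum>i<length I. M ! i ! j)"
      by (rule sum.swap)
    also have "\<dots> = sum_list J"
      using M by (simp add: int_matrices_def sum_list_sum_nth atLeast0LessThan)
    finally show False using assms by simp
  qed
  then show ?thesis by blast
qed

lemma iprod_eq_lin_ext: "iprod F G = lin_ext (\<lambda>I. S_left (parts I) G) F"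
proof -
  have basis: "iprod_basis I J = S_left (parts I) (Sb (parts J))" for I J
    by (simp add: iprod_basis_def S_left_Sb int_matrices_eq_empty)
  have "S_left (parts I) G = (\<Sum>J\<in>Poly_Mapping.keys G.
      smult_sym (Poly_Mapping.lookup G J) (iprod_basis I J))" for I
    by (subst sym_expansion_Sb [of G]) (simp add: lin_opD [OF lin_op_S_left] basis)
  then show ?thesis
    by (simp add: iprod_def lin_ext_def sym.scale_sum_right)
qed

lemma lin_op_iprod_left: "lin_op (\<lambda>F. iprod F G)"
  unfolding iprod_eq_lin_ext by (rule lin_op_lin_ext)

lemma lin_op_iprod_right: "lin_op (iprod F)"
  by (rule lin_opI)
    (simp_all add: iprod_eq_lin_ext lin_opD [OF lin_op_S_left] lin_ext_add_fun lin_ext_smult_fun)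

lemma iprod_Sb: "0 \<notin> set I \<Longrightarrow> iprod (Sb I) G = S_left I G"
  by (simp add: iprod_eq_lin_ext lin_ext_Sb Composition_inverse)

section \<open>Grouplike series\<close>

text \<open>The last clause says that the coproduct of the component in degree \<open>n\<close> is
  the sum of the tensors of the components in degrees \<open>a\<close> and \<open>n - a\<close>,
  tested by all bilinear maps. The extra right factor \<open>G\<close> builds in multiplicativity,
  so that products of series can be treated by applying the clause twice.\<close>

definition grouplike :: "sym fps \<Rightarrow> bool"
  where "grouplike g \<longleftrightarrow> fps_nth g 0 = 1 \<and> (\<forall>n. fps_nth g n \<in> Sym_hom n) \<and>
    (\<forall>\<Psi> n G. bilin_op \<Psi> \<longrightarrow> cop \<Psi> (fps_nth g n * G) =
      (\<Sum>a\<le>n. cop (\<lambda>A B. \<Psi> (fps_nth g a * A) (fps_nth g (n - a) * B)) G))"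

lemma grouplikeD:
  assumes "grouplike g"
  shows "fps_nth g 0 = 1" "fps_nth g n \<in> Sym_hom n"
    "bilin_op \<Psi> \<Longrightarrow> cop \<Psi> (fps_nth g n * G) =
      (\<Sum>a\<le>n. cop (\<lambda>A B. \<Psi> (fps_nth g a * A) (fps_nth g (n - a) * B)) G)"
  using assms by (auto simp: grouplike_def)

text \<open>In the coproduct of a component of \<open>g\<close>, \<open>hom_part i\<close> leaves
  only the term with \<open>g_i\<close> on the left. Each row therefore contributes one
  factor.\<close>

lemma S_left_grouplike:
  assumes "grouplike g"
  shows "S_left I (fps_nth g n) =
    (if n = sum_list I then prod_list (map (fps_nth g) I) else 0)"
proof (induction I arbitrary: n)
  case Nil
  show ?case
    using grouplikeD(1,2) [OF assms] lookup_0_Sym_hom [of "fps_nth g n" n]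
    by (cases "n = 0") (auto simp: lookup_one)
next
  case (Cons i I)
  have "S_left (i # I) (fps_nth g n) = cop (\<lambda>A B. hom_part i A * S_left I B) (fps_nth g n * 1)"
    by simp
  also have "\<dots> = (\<Sum>a\<le>n. hom_part i (fps_nth g a) * S_left I (fps_nth g (n - a)))"
    by (subst grouplikeD(3) [OF assms bilin_op_row]) (simp add: cop_1)
  also have "\<dots> = (\<Sum>a\<le>n. if a = i then fps_nth g i * S_left I (fps_nth g (n - i)) else 0)"
    by (rule sum.cong) (auto simp: hom_part_Sym_hom [OF grouplikeD(2) [OF assms]])
  finally show ?case
    by (auto simp: Cons)
qed

lemma grouplike_S:
  "grouplike (Abs_fps (\<lambda>n. smult_sym (x ^ n) (S n)))"
proof -
  have "cop \<Psi> (S n * G) = (\<Sum>a\<le>n. cop (\<lambda>A B. \<Psi> (S a * A) (S (n - a) * B)) G)" for \<Psi> n G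
    by (rule cop_S_mult)
  then have "cop \<Psi> (smult_sym (x ^ n) (S n) * G) =
      (\<Sum>a\<le>n. cop (\<lambda>A B. \<Psi> (smult_sym (x ^ a) (S a) * A) (smult_sym (x ^ (n - a)) (S (n - a)) * B)) G)"
    if \<Psi>: "bilin_op \<Psi>" for \<Psi> n G
    by (simp add: lin_opD [OF lin_op_cop] lin_opD [OF bilin_opD(1) [OF \<Psi>]]
        lin_opD [OF bilin_opD(2) [OF \<Psi>]] cop_smult_fun sym.scale_sum_right flip: power_add)
  then show ?thesis
    by (simp add: grouplike_def S_in_Sym_hom sym.subspace_scale [OF subspace_Sym_hom])
qed

text \<open>Both sides run over all quadruples of naturals with sum \<open>n\<close>; exchanging the
  two middle entries is an involution of this set.\<close>

lemma sum_swap_middle: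
  fixes f :: "nat \<Rightarrow> nat \<Rightarrow> nat \<Rightarrow> nat \<Rightarrow> 'a::comm_monoid_add"
  shows "(\<Sum>a\<le>n. \<Sum>b\<le>a. \<Sum>c\<le>n - a. f b (a - b) c (n - a - c)) =
    (\<Sum>a\<le>n. \<Sum>b\<le>a. \<Sum>c\<le>n - a. f b c (a - b) (n - a - c))"
proof -
  let ?X = "SIGMA a:{..n}. {..a} \<times> {..n - a}" and ?h = "\<lambda>(a, b, c). (b + c, b, a - b)"
  have "(\<Sum>(a, b, c)\<in>?X. f b (a - b) c (n - a - c)) = (\<Sum>(a, b, c)\<in>?X. f b c (a - b) (n - a - c))"
    by (rule sum.reindex_bij_witness [where i = ?h and j = ?h]) (auto simp: add.commute)
  then show ?thesis
    by (simp add: sum.Sigma sum.cartesian_product case_prod_unfold)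
qed

lemma grouplike_mult:
  assumes g: "grouplike g" and h: "grouplike h"
  shows "grouplike (g * h)"
proof -
  have nth: "fps_nth (g * h) n = (\<Sum>a\<le>n. fps_nth g a * fps_nth h (n - a))" for n
    by (simp add: fps_mult_nth atLeast0AtMost)
  have "cop \<Psi> (fps_nth (g * h) n * G) =
      (\<Sum>a\<le>n. cop (\<lambda>A B. \<Psi> (fps_nth (g * h) a * A) (fps_nth (g * h) (n - a) * B)) G)"
    if \<Psi>: "bilin_op \<Psi>" for \<Psi> n G
  proof -
    \<comment> \<open>The term with \<open>g_a1 h_b1\<close> in the left and
      \<open>g_a2 h_b2\<close> in the right tensor factor. The exchange of the two middle indices
      regroups by the factors of the tensor square instead of by \<open>g\<close> and
      \<open>h\<close>.\<close>
    define f where "f = (\<lambda>a1 a2 b1 b2. cop (\<lambda>A B.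
      \<Psi> (fps_nth g a1 * (fps_nth h b1 * A)) (fps_nth g a2 * (fps_nth h b2 * B))) G)"
    have "cop \<Psi> (fps_nth (g * h) n * G) =
        (\<Sum>a\<le>n. cop \<Psi> (fps_nth g a * (fps_nth h (n - a) * G)))"
      by (simp add: nth sum_distrib_right lin_opD [OF lin_op_cop] mult.assoc)
    also have "\<dots> = (\<Sum>a\<le>n. \<Sum>b\<le>a. \<Sum>c\<le>n - a. f b (a - b) c (n - a - c))"
      by (simp add: grouplikeD(3) [OF g \<Psi>] grouplikeD(3) [OF h bilin_op_mult [OF \<Psi>]] f_def)
    also have "\<dots> = (\<Sum>a\<le>n. \<Sum>b\<le>a. \<Sum>c\<le>n - a. f b c (a - b) (n - a - c))"
      by (rule sum_swap_middle)
    also have "\<dots> = (\<Sum>a\<le>n. cop (\<lambda>A B. \<Psi> (fps_nth (g * h) a * A) (fps_nth (g * h) (n - a) * B)) G)"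
      by (simp add: nth f_def sum_distrib_right mult.assoc cop_sum_fun
          lin_opD [OF bilin_opD(1) [OF \<Psi>]] lin_opD [OF bilin_opD(2) [OF \<Psi>]])
        (rule sum.cong [OF refl sum.swap])
    finally show ?thesis .
  qed
  moreover have "fps_nth (g * h) n \<in> Sym_hom n" for n
    unfolding nth using Sym_hom_mult [OF grouplikeD(2) [OF g] grouplikeD(2) [OF h]]
    by (intro sym.subspace_sum [OF subspace_Sym_hom]) (metis atMost_iff le_add_diff_inverse)
  ultimately show ?thesis
    unfolding grouplike_def using grouplikeD(1) [OF g] grouplikeD(1) [OF h] by simp
qed

lemma grouplike_1: "grouplike 1"
proof -
  have "(\<Sum>a\<le>n. cop (\<lambda>A B. \<Psi> (fps_nth 1 a * A) (fps_nth 1 (n - a) * B)) G) =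
      cop \<Psi> (fps_nth 1 n * G)" if \<Psi>: "bilin_op \<Psi>" for \<Psi> n G
  proof -
    have 0: "cop (\<lambda>A B. 0) G = 0"
      using cop_smult_fun [of 0 "\<lambda>A B. 0" G] by simp
    show ?thesis
    proof (cases "n = 0")
      case False
      have "cop (\<lambda>A B. \<Psi> (fps_nth 1 a * A) (fps_nth 1 (n - a) * B)) G = 0" if "a \<le> n" for a
        using False that 0
        by (cases "a = 0") (simp_all add: lin_opD [OF bilin_opD(1) [OF \<Psi>]] lin_opD [OF bilin_opD(2) [OF \<Psi>]])
      then show ?thesis using False by (simp add: lin_opD [OF lin_op_cop])
    qed simp
  qed
  then show ?thesis
    by (auto simp: grouplike_def sym.subspace_0 [OF subspace_Sym_hom])
qed

lemma grouplike_prod_list: "(\<And>g. g \<in> set gs \<Longrightarrow> grouplike g) \<Longrightarrow> grouplike (prod_list gs)"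
  by (induction gs) (simp_all add: grouplike_1 grouplike_mult)

section \<open>The exponential series of multiples of \<open>S 1\<close>\<close>

definition exp_S1 :: "complex \<Rightarrow> sym fps"
  where "exp_S1 t = Abs_fps (\<lambda>n. smult_sym (t ^ n / fact n) (S 1 ^ n))"

lemma exp_S1_nth: "fps_nth (exp_S1 t) n = smult_sym (t ^ n / fact n) (S 1 ^ n)"
  by (simp add: exp_S1_def)

text \<open>\<open>S 1\<close> is primitive, and its two tensor parts commute, so the binomial
  theorem holds; the induction step is Pascal's rule.\<close>

lemma cop_S1_power_mult:
  "cop \<Psi> (S 1 ^ n * G) =
    (\<Sum>a\<le>n. smult_sym (of_nat (n choose a)) (cop (\<lambda>A B. \<Psi> (S 1 ^ a * A) (S 1 ^ (n - a) * B)) G))"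
proof (induction n arbitrary: \<Psi>)
  case (Suc n)
  define f where "f = (\<lambda>a b. cop (\<lambda>A B. \<Psi> (S 1 ^ a * A) (S 1 ^ b * B)) G)"
  have step: "cop \<Psi> (S 1 * H) = cop (\<lambda>A B. \<Psi> A (S 1 * B)) H + cop (\<lambda>A B. \<Psi> (S 1 * A) B) H" for H
    using cop_S_mult [of \<Psi> 1 H] by simp
  have "cop \<Psi> (S 1 ^ Suc n * G) = cop \<Psi> (S 1 * (S 1 ^ n * G))"
    by (simp add: mult.assoc)
  also have "\<dots> = (\<Sum>a\<le>n. smult_sym (of_nat (n choose a)) (f a (Suc n - a)))
      + (\<Sum>a\<le>n. smult_sym (of_nat (n choose a)) (f (Suc a) (n - a)))"
    unfolding step Suc f_def by (simp add: mult.assoc Suc_diff_le)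
  also have "(\<Sum>a\<le>n. smult_sym (of_nat (n choose a)) (f a (Suc n - a))) =
      f 0 (Suc n) + (\<Sum>a\<le>n. smult_sym (of_nat (n choose Suc a)) (f (Suc a) (n - a)))"
    using sum.atMost_Suc_shift [of "\<lambda>a. smult_sym (of_nat (n choose a)) (f a (Suc n - a))" n]
    by (simp add: binomial_eq_0)
  also have "\<dots> + (\<Sum>a\<le>n. smult_sym (of_nat (n choose a)) (f (Suc a) (n - a))) =
      (\<Sum>a\<le>Suc n. smult_sym (of_nat (Suc n choose a)) (f a (Suc n - a)))"
    by (subst sum.atMost_Suc_shift)
      (simp add: sym.scale_left_distrib sum.distrib algebra_simps)
  finally show ?case by (simp add: f_def)
qed simp

lemma S1_power_in_Sym_hom: "S 1 ^ n \<in> Sym_hom n"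
  using Sb_in_Sym_hom [of "replicate n 1"] by (simp add: Sb_def sum_list_replicate)

lemma grouplike_exp_S1: "grouplike (exp_S1 t)"
proof -
  have "cop \<Psi> (fps_nth (exp_S1 t) n * G) =
      (\<Sum>a\<le>n. cop (\<lambda>A B. \<Psi> (fps_nth (exp_S1 t) a * A) (fps_nth (exp_S1 t) (n - a) * B)) G)"
    if \<Psi>: "bilin_op \<Psi>" for \<Psi> n G
  proof -
    have "t ^ n / fact n * of_nat (n choose a) = t ^ a / fact a * (t ^ (n - a) / fact (n - a))"
      if "a \<le> n" for a
      using that by (simp add: binomial_fact flip: power_add)
    then show ?thesis
      using cop_S1_power_mult [of \<Psi> n G]
      by (simp add: exp_S1_nth lin_opD [OF lin_op_cop] lin_opD [OF bilin_opD(1) [OF \<Psi>]]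
        lin_opD [OF bilin_opD(2) [OF \<Psi>]] cop_smult_fun sym.scale_sum_right)
        (simp add: mult.commute)
  qed
  then show ?thesis
    by (simp add: grouplike_def exp_S1_nth S1_power_in_Sym_hom [unfolded One_nat_def]
        sym.subspace_scale [OF subspace_Sym_hom])
qed

text \<open>\<open>subst_series g\<close> is the algebra endomorphism with \<open>S_n \<mapsto> g_n\<close>.\<close>

definition subst_series :: "sym fps \<Rightarrow> sym \<Rightarrow> sym"
  where "subst_series g = lin_ext (\<lambda>I. prod_list (map (fps_nth g) (parts I)))"

lemma lin_op_subst_series: "lin_op (subst_series g)"
  by (simp add: subst_series_def lin_op_lin_ext)

context
  fixes g :: "sym fps"
  assumes g0: "fps_nth g 0 = 1"
begin

lemma subst_series_Sb: "subst_series g (Sb J) = prod_list (map (fps_nth g) J)"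
proof -
  have "prod_list (map (fps_nth g) (filter ((<) 0) J)) = prod_list (map (fps_nth g) J)" for J
    using g0 by (induction J) auto
  then show ?thesis
    unfolding subst_series_def by (rule lin_ext_Sb_list)
qed

lemma subst_series_S: "subst_series g (S n) = fps_nth g n"
  using subst_series_Sb [of "[n]"] by simp

lemma subst_series_1: "subst_series g 1 = 1"
  using subst_series_Sb [of "[]"] by simp

lemma subst_series_mult: "subst_series g (F * G) = subst_series g F * subst_series g G"
proof (rule lin_op_eqI [where f = "\<lambda>F. subst_series g (F * G)"])
  show "lin_op (\<lambda>F. subst_series g (F * G))"
    by (rule lin_op_compose [OF lin_op_subst_series lin_op_mult_right])
  show "lin_op (\<lambda>F. subst_series g F * subst_series g G)"
    by (rule lin_op_compose [OF lin_op_mult_right lin_op_subst_series])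
  fix J :: "nat list"
  show "subst_series g (Sb J * G) = subst_series g (Sb J) * subst_series g G"
  proof (rule lin_op_eqI [where f = "\<lambda>G. subst_series g (Sb J * G)"])
    show "lin_op (\<lambda>G. subst_series g (Sb J * G))"
      by (rule lin_op_compose [OF lin_op_subst_series lin_op_mult_left])
    show "lin_op (\<lambda>G. subst_series g (Sb J) * subst_series g G)"
      by (rule lin_op_compose [OF lin_op_mult_left lin_op_subst_series])
    show "subst_series g (Sb J * Sb K) = subst_series g (Sb J) * subst_series g (Sb K)" for K
      by (simp add: subst_series_Sb flip: Sb_simps)
  qed
qed

lemma subst_series_power: "subst_series g (F ^ n) = subst_series g F ^ n"
  by (induction n) (simp_all add: subst_series_1 subst_series_mult)

end

lemma subst_series_in_Sym_hom:
  assumes "fps_nth g 0 = 1" "\<And>n. fps_nth g n \<in> Sym_hom n" "F \<in> Sym_hom n"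
  shows "subst_series g F \<in> Sym_hom n"
  using assms(3)
proof (induction rule: Sym_hom_induct)
  case subspace
  show ?case
    using subspace_Sym_hom [of n] by (simp add: sym.subspace_def lin_opD [OF lin_op_subst_series])
next
  case (basis J)
  have "prod_list (map (fps_nth g) J) \<in> Sym_hom (sum_list J)"
    by (induction J) (simp_all add: Sym_hom_mult assms(2))
  with basis show ?case by (simp add: subst_series_Sb assms(1))
qed

lemma subst_series_comp:
  assumes "fps_nth g 0 = 1" "fps_nth h 0 = 1" "fps_nth h' 0 = 1"
    and "\<And>m. subst_series g (fps_nth h m) = fps_nth h' m"
  shows "subst_series g (subst_series h F) = subst_series h' F"
proof (rule lin_op_eqI [where f = "\<lambda>F. subst_series g (subst_series h F)"])
  show "lin_op (\<lambda>F. subst_series g (subst_series h F))"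
    by (rule lin_op_compose [OF lin_op_subst_series lin_op_subst_series])
  have "subst_series g (prod_list (map (fps_nth h) J)) = prod_list (map (fps_nth h') J)" for J
    by (induction J) (simp_all add: subst_series_1 subst_series_mult assms)
  then show "subst_series g (subst_series h (Sb J)) = subst_series h' (Sb J)" for J
    by (simp add: subst_series_Sb assms)
qed (rule lin_op_subst_series)

text \<open>By \<open>S_left_grouplike\<close> the value at a basis element is the product of the
  components of \<open>g\<close> indexed by its parts, as for the endomorphism; both sides are
  linear in \<open>F\<close>.\<close>

lemma iprod_grouplike:
  assumes g: "grouplike g" and F: "F \<in> Sym_hom n"
  shows "iprod F (fps_nth g n) = subst_series g F"
  using F
proof (induction rule: Sym_hom_induct)
  case subspace
  show ?case
    by (auto simp: sym.subspace_def lin_opD [OF lin_op_iprod_left] lin_opD [OF lin_op_subst_series])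
next
  case (basis J)
  then show ?case
    by (simp add: iprod_Sb S_left_grouplike [OF g] subst_series_Sb grouplikeD(1) [OF g])
qed

section \<open>The algebras in terms of grouplike series\<close>

text \<open>The variable of the formal series records the degree. The parameter \<open>x\<close> is
  a complex number, varied later for interpolation.\<close>

definition S_fps :: "complex \<Rightarrow> sym fps"
  where "S_fps x = Abs_fps (\<lambda>n. smult_sym (x ^ n) (S n))"

definition sharp_fps :: "complex \<Rightarrow> sym fps"
  where "sharp_fps x = exp_S1 (- x) * S_fps x"

lemma S_fps_nth: "fps_nth (S_fps x) n = smult_sym (x ^ n) (S n)"
  by (simp add: S_fps_def)

lemma sharp_fps_nth: "fps_nth (sharp_fps x) n = smult_sym (x ^ n) (S_sharp n)"
proof -
  have "x ^ (n - i) * ((- x) ^ i / fact i) = x ^ n * ((- 1) ^ i / fact i)" if "i \<le> n" for i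
    using that by (simp add: power_minus [of x] flip: power_add)
  then show ?thesis
    by (simp add: sharp_fps_def fps_mult_nth atLeast0AtMost exp_S1_nth S_fps_nth S_sharp_def
        sym.scale_sum_right)
qed

lemma grouplike_S_fps: "grouplike (S_fps x)"
  unfolding S_fps_def by (rule grouplike_S)

lemma grouplike_sharp_fps: "grouplike (sharp_fps x)"
  unfolding sharp_fps_def by (intro grouplike_mult grouplike_exp_S1 grouplike_S_fps)

lemma grouplike_sharps: "grouplike (prod_list (map sharp_fps xs))"
  by (rule grouplike_prod_list) (auto simp: grouplike_sharp_fps)

lemma sharp_fps_1_nth: "fps_nth (sharp_fps 1) = S_sharp"
  by (rule ext) (simp add: sharp_fps_nth)

section \<open>The subalgebra generated by the elements \<open>S_sharp n\<close>\<close>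

lemma S_sharp_0 [simp]: "S_sharp 0 = 1"
  by (simp add: S_sharp_def)

lemma S_sharp_1 [simp]: "S_sharp (Suc 0) = 0"
  by (simp add: S_sharp_def)

lemma S_sharp_in_Sym_hom: "S_sharp n \<in> Sym_hom n"
  using grouplikeD(2) [OF grouplike_sharp_fps, of 1 n] by (simp add: sharp_fps_1_nth)

text \<open>\<open>S_sharp n\<close> is a component of the grouplike series
  \<open>sharp_fps 1\<close>, so \<open>D0 n\<close> consists of the elements of degree
  \<open>n\<close> in the image of an algebra endomorphism. This makes it visible that the ordinary
  product adds the indices of \<open>D0\<close>.\<close>

lemma D0_eq: "D0 n = subst_series (sharp_fps 1) ` Sym_hom n"
proof -
  have "iprod F (S_sharp n) = subst_series (sharp_fps 1) F" if "F \<in> Sym_hom n" for F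
    using iprod_grouplike [OF grouplike_sharp_fps [of 1] that] by (simp add: sharp_fps_1_nth)
  then show ?thesis
    by (force simp: D0_def)
qed

lemma subst_sharp_Sb: "subst_series (sharp_fps 1) (Sb J) = prod_list (map S_sharp J)"
  by (subst subst_series_Sb) (simp_all add: sharp_fps_1_nth)

lemma subspace_D0: "sym.subspace (D0 n)"
  unfolding sym.subspace_def D0_eq
proof (intro conjI ballI allI)
  note L = lin_opD [OF lin_op_subst_series [of "sharp_fps 1"], symmetric]
  show "0 \<in> subst_series (sharp_fps 1) ` Sym_hom n"
    using sym.subspace_0 [OF subspace_Sym_hom] by (auto simp: lin_opD [OF lin_op_subst_series] intro!: image_eqI [of _ _ 0])
  fix F
  assume "F \<in> subst_series (sharp_fps 1) ` Sym_hom n"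
  then obtain F' where F: "F = subst_series (sharp_fps 1) F'" "F' \<in> Sym_hom n" by auto
  show "smult_sym c F \<in> subst_series (sharp_fps 1) ` Sym_hom n" for c
    using F(2) unfolding F(1) L by (intro imageI sym.subspace_scale [OF subspace_Sym_hom])
  fix G
  assume "G \<in> subst_series (sharp_fps 1) ` Sym_hom n"
  then obtain G' where G: "G = subst_series (sharp_fps 1) G'" "G' \<in> Sym_hom n" by auto
  show "F + G \<in> subst_series (sharp_fps 1) ` Sym_hom n"
    using F(2) G(2) unfolding F(1) G(1) L by (intro imageI sym.subspace_add [OF subspace_Sym_hom])
qed

lemma D0_mult:
  assumes "F \<in> D0 a" "G \<in> D0 b"
  shows "F * G \<in> D0 (a + b)"
  using assms unfolding D0_eq
  by (auto simp: sharp_fps_nth Sym_hom_mult simp flip: subst_series_mult)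

lemma sharps_in_D0: "prod_list (map S_sharp J) \<in> D0 (sum_list J)"
  unfolding D0_eq subst_sharp_Sb [symmetric] by (intro imageI Sb_in_Sym_hom)

lemma one_in_D0 [simp]: "1 \<in> D0 0"
  using sharps_in_D0 [of "[]"] by simp

lemma S_sharp_in_D0: "S_sharp n \<in> D0 n"
  using sharps_in_D0 [of "[n]"] by simp

lemma D0_induct [consumes 1, case_names subspace basis]:
  assumes "F \<in> D0 n" "sym.subspace {F. P F}"
    "\<And>J. sum_list J = n \<Longrightarrow> P (prod_list (map S_sharp J))"
  shows "P F"
proof -
  obtain F' where "F = subst_series (sharp_fps 1) F'" "F' \<in> Sym_hom n"
    using assms(1) by (auto simp: D0_eq)
  moreover have "P (subst_series (sharp_fps 1) F')"
    using \<open>F' \<in> Sym_hom n\<close>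
  proof (induction rule: Sym_hom_induct)
    case subspace
    show ?case
      using assms(2) by (simp add: sym.subspace_def lin_opD [OF lin_op_subst_series])
  next
    case (basis J)
    then show ?case using assms(3) by (simp add: subst_sharp_Sb)
  qed
  ultimately show ?thesis by simp
qed

lemma D0_subset_Sym_hom: "D0 n \<subseteq> Sym_hom n"
proof
  fix F
  assume "F \<in> D0 n"
  then show "F \<in> Sym_hom n"
    unfolding D0_eq
    by (auto intro!: subst_series_in_Sym_hom simp: sharp_fps_nth S_sharp_in_Sym_hom)
qed

lemma sharps_nth_in_D0: "fps_nth (prod_list (map sharp_fps xs)) n \<in> D0 n"
proof (induction xs arbitrary: n)
  case Nil
  show ?case using sym.subspace_0 [OF subspace_D0] by (cases "n = 0") simp_all
next
  case (Cons x xs)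
  have "smult_sym (x ^ a) (S_sharp a) * fps_nth (prod_list (map sharp_fps xs)) (n - a) \<in> D0 n"
    if "a \<le> n" for a
    using D0_mult [OF S_sharp_in_D0 Cons, of a "n - a"] that
    by (simp add: sym.subspace_scale [OF subspace_D0])
  then show ?case
    by (auto simp: fps_mult_nth sharp_fps_nth atLeast0AtMost intro!: sym.subspace_sum [OF subspace_D0])
qed

lemma subst_series_in_D0:
  assumes "fps_nth h 0 = 1" "\<And>m. fps_nth h m \<in> D0 m" "F \<in> Sym_hom n"
  shows "subst_series h F \<in> D0 n"
  using assms(3)
proof (induction rule: Sym_hom_induct)
  case subspace
  show ?case
    using subspace_D0 [of n] by (simp add: sym.subspace_def lin_opD [OF lin_op_subst_series])
next
  case (basis J)
  have "prod_list (map (fps_nth h) J) \<in> D0 (sum_list J)"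
    by (induction J) (simp_all add: D0_mult assms(2))
  with basis show ?case by (simp add: subst_series_Sb assms(1))
qed

section \<open>The spaces \<open>D n k\<close> under sums and ordinary products\<close>

lemma subspace_D: "sym.subspace (D n k)"
  unfolding sym.subspace_def
proof (intro conjI ballI allI)
  show "0 \<in> D n k"
    using sym.subspace_0 [OF subspace_D0] by (auto simp: D_def intro!: exI [of _ "\<lambda>_. 0"])
  fix F
  assume "F \<in> D n k"
  then obtain F' where F: "F = (\<Sum>j\<le>min k n. S j * F' j)" "\<forall>j\<le>min k n. F' j \<in> D0 (n - j)"
    by (auto simp: D_def)
  show "smult_sym c F \<in> D n k" for c
    using F sym.subspace_scale [OF subspace_D0]
    by (auto simp: D_def sym.scale_sum_right intro!: exI [of _ "\<lambda>j. smult_sym c (F' j)"])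
  fix G
  assume "G \<in> D n k"
  then obtain G' where G: "G = (\<Sum>j\<le>min k n. S j * G' j)" "\<forall>j\<le>min k n. G' j \<in> D0 (n - j)"
    by (auto simp: D_def)
  show "F + G \<in> D n k"
    using F G sym.subspace_add [OF subspace_D0]
    by (auto simp: D_def sum.distrib distrib_left intro!: exI [of _ "\<lambda>j. F' j + G' j"])
qed

lemma S_mult_in_D:
  assumes "j \<le> k" "G \<in> D0 m" "n = j + m"
  shows "S j * G \<in> D n k"
proof -
  have "(\<Sum>i\<le>min k n. S i * (if i = j then G else 0)) = S j * G"
    using assms by (simp add: if_distrib cong: if_cong)
  moreover have "(if i = j then G else 0) \<in> D0 (n - i)" for i
    using assms sym.subspace_0 [OF subspace_D0] by auto
  ultimately show ?thesis
    unfolding D_def by (auto intro!: exI [of _ "\<lambda>i. if i = j then G else 0"])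
qed

lemma D_cases [consumes 1, case_names subspace basis]:
  assumes "F \<in> D n k" "sym.subspace {F. P F}"
    "\<And>j G. j \<le> k \<Longrightarrow> j \<le> n \<Longrightarrow> G \<in> D0 (n - j) \<Longrightarrow> P (S j * G)"
  shows "P F"
proof -
  obtain F' where F: "F = (\<Sum>j\<le>min k n. S j * F' j)" "\<forall>j\<le>min k n. F' j \<in> D0 (n - j)"
    using assms(1) by (auto simp: D_def)
  have "(\<Sum>j\<le>min k n. S j * F' j) \<in> {F. P F}"
    using F assms by (intro sym.subspace_sum) auto
  then show ?thesis using F by simp
qed

lemma D_mono:
  assumes "j \<le> k"
  shows "D n j \<subseteq> D n k"
proof
  fix F
  assume "F \<in> D n j"
  then show "F \<in> D n k"
    by (induction rule: D_cases) (use assms subspace_D in \<open>auto intro: S_mult_in_D\<close>)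
qed

lemma D_subset_Sym_hom: "D n k \<subseteq> Sym_hom n"
proof
  fix F
  assume "F \<in> D n k"
  then show "F \<in> Sym_hom n"
  proof (induction rule: D_cases)
    case subspace
    show ?case using subspace_Sym_hom by simp
  next
    case (basis j G)
    then show ?case
      using Sym_hom_mult [OF S_in_Sym_hom, of G "n - j" j] D0_subset_Sym_hom by auto
  qed
qed

lemma D_mult_D0:
  assumes F: "F \<in> D a k" and H: "H \<in> D0 b"
  shows "F * H \<in> D (a + b) k"
  using F
proof (induction rule: D_cases)
  case subspace
  show ?case
    using subspace_D [of "a + b" k] by (simp add: sym.subspace_def distrib_right)
next
  case (basis j G)
  then have "S j * (G * H) \<in> D (a + b) k"
    by (intro S_mult_in_D [OF _ D0_mult [OF _ H]]) auto
  then show ?case by (simp add: mult.assoc)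
qed

text \<open>Each coefficient of a polynomial is a linear combination of its values.\<close>

lemma subspace_coefficients:
  assumes X: "sym.subspace X" and "\<And>x. (\<Sum>m\<le>N. smult_sym (x ^ m) (H m)) \<in> X"
  shows "m \<le> N \<Longrightarrow> H m \<in> X"
  using assms(2)
proof (induction N arbitrary: H m)
  case 0
  then show ?case using "0.prems"(2) [of 1] by simp
next
  case (Suc N)
  define p where "p = (\<lambda>x. \<Sum>m\<le>Suc N. smult_sym (x ^ m) (H m))"
  have p: "p x \<in> X" for x
    unfolding p_def by (rule Suc.prems(2))
  \<comment> \<open>The combination of the values at \<open>2 * x\<close> and \<open>x\<close> below
    cancels the top coefficient and multiplies the others by \<open>2 ^ m - 2 ^ Suc N\<close>, which
    is nonzero. This reduces the degree.\<close>
  have "smult_sym (2 ^ m - 2 ^ Suc N) (H m) \<in> X" if "m \<le> N" for m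
  proof (rule Suc.IH [where H = "\<lambda>m. smult_sym (2 ^ m - 2 ^ Suc N) (H m)", OF that])
    fix x :: complex
    have "p (2 * x) - smult_sym (2 ^ Suc N) (p x) =
        (\<Sum>m\<le>N. smult_sym (x ^ m) (smult_sym (2 ^ m - 2 ^ Suc N) (H m)))"
      by (simp add: p_def power_mult_distrib sym.scale_sum_right sym.scale_right_distrib
          sum_subtractf [symmetric] algebra_simps flip: sym.scale_left_diff_distrib)
    moreover have "p (2 * x) - smult_sym (2 ^ Suc N) (p x) \<in> X"
      by (intro sym.subspace_diff [OF X] sym.subspace_scale [OF X] p)
    ultimately show "(\<Sum>m\<le>N. smult_sym (x ^ m) (smult_sym (2 ^ m - 2 ^ Suc N) (H m))) \<in> X" by simp
  qed
  moreover have "(2 :: complex) ^ m - 2 ^ Suc N \<noteq> 0" if "m \<le> N" for m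
  proof -
    have "(2 :: nat) ^ m \<noteq> 2 ^ Suc N" using that power_inject_exp [of "2 :: nat" m "Suc N"] by auto
    then have "of_nat (2 ^ m) \<noteq> (of_nat (2 ^ Suc N) :: complex)" by (simp only: of_nat_eq_iff not_False_eq_True)
    then show ?thesis by simp
  qed
  ultimately have low: "H m \<in> X" if "m \<le> N" for m
    using that sym.subspace_scale [OF X, of "smult_sym (2 ^ m - 2 ^ Suc N) (H m)" "1 / (2 ^ m - 2 ^ Suc N)"]
    by simp
  moreover have "H (Suc N) \<in> X"
  proof -
    have "H (Suc N) = p 1 - (\<Sum>m\<le>N. H m)"
      by (simp add: p_def)
    then show ?thesis
      using low by (auto intro!: sym.subspace_diff [OF X] sym.subspace_sum [OF X] p)
  qed
  ultimately show ?case
    using Suc.prems(1) le_Suc_eq by blast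
qed

text \<open>Interpolation in the first parameter isolates the factor \<open>S_sharp j\<close>. It is
  then absorbed into \<open>F\<close>, and the induction continues with the remaining
  parameters.\<close>

lemma sharps_in_subspace:
  assumes X: "sym.subspace X"
  shows "(\<And>xs. F * fps_nth (prod_list (map sharp_fps xs)) m \<in> X) \<Longrightarrow> sum_list J = m \<Longrightarrow>
    F * prod_list (map S_sharp J) \<in> X"
proof (induction J arbitrary: F m)
  case Nil
  then show ?case using Nil(1) [of "[]"] by simp
next
  case (Cons j J)
  have "F * S_sharp j * prod_list (map S_sharp J) \<in> X"
  proof (rule Cons.IH)
    fix xs
    let ?h = "prod_list (map sharp_fps xs)"
    have "F * S_sharp j * fps_nth ?h (m - j) \<in> X"
    proof (rule subspace_coefficients [OF X, where N = m and m = j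
        and H = "\<lambda>j. F * S_sharp j * fps_nth ?h (m - j)"])
      fix x
      have "F * fps_nth (prod_list (map sharp_fps (x # xs))) m \<in> X"
        by (rule Cons.prems(1))
      then show "(\<Sum>j\<le>m. smult_sym (x ^ j) (F * S_sharp j * fps_nth ?h (m - j))) \<in> X"
        by (simp add: fps_mult_nth atLeast0AtMost sharp_fps_nth sum_distrib_left mult.assoc)
    qed (use Cons.prems in simp)
    then show "F * S_sharp j * fps_nth ?h (sum_list J) \<in> X"
      using Cons.prems by auto
  qed simp
  then show ?case by (simp add: mult.assoc)
qed

section \<open>Grouplike series whose components span enough to reach \<open>D n k\<close>\<close>

definition gen :: "complex \<Rightarrow> complex list \<Rightarrow> sym fps"
  where "gen x xs = S_fps x * prod_list (map sharp_fps xs)"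

lemma grouplike_gen: "grouplike (gen x xs)"
  unfolding gen_def by (intro grouplike_mult grouplike_S_fps grouplike_sharps)

lemma gen_nth:
  "fps_nth (gen x xs) n = (\<Sum>j\<le>n. smult_sym (x ^ j) (S j * fps_nth (prod_list (map sharp_fps xs)) (n - j)))"
  by (simp add: gen_def fps_mult_nth atLeast0AtMost S_fps_nth)

text \<open>Interpolation in \<open>x\<close> isolates the factor \<open>S j\<close>, interpolation
  in \<open>xs\<close> the product of the \<open>S_sharp\<close> behind it. The components of
  \<open>gen x xs\<close> need not lie in \<open>D n k\<close>, so \<open>P\<close> must be a
  property that makes sense outside it.\<close>

lemma D_induct [consumes 1, case_names subspace gen]:
  assumes F: "F \<in> D n k" and P: "sym.subspace {F. P F}" and gen: "\<And>x xs. P (fps_nth (gen x xs) n)"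
  shows "P F"
  using F
proof (induction rule: D_cases)
  case (basis j G)
  have h: "S j * fps_nth (prod_list (map sharp_fps xs)) (n - j) \<in> {F. P F}" for xs
    by (rule subspace_coefficients [OF P, where N = n and m = j
        and H = "\<lambda>j. S j * fps_nth (prod_list (map sharp_fps xs)) (n - j)"])
      (use gen basis in \<open>simp_all add: gen_nth\<close>)
  show ?case
    using basis(3)
  proof (induction rule: D0_induct)
    case subspace
    show ?case using P by (simp add: sym.subspace_def distrib_left)
  next
    case (basis J)
    show ?case using sharps_in_subspace [OF P h basis] by simp
  qed
qed (rule P)

lemma smult_sym_power: "smult_sym c F ^ n = smult_sym (c ^ n) (F ^ n)"
  by (induction n) (simp_all add: mult.commute)

lemma sharps_nth_1: "fps_nth (prod_list (map sharp_fps xs)) (Suc 0) = 0"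
  by (induction xs) (simp_all add: fps_mult_nth sharp_fps_nth)

text \<open>The endomorphism sends \<open>S 1\<close> to \<open>x\<close> times \<open>S 1\<close>,
  hence \<open>exp (- S_1) \<sigma>\<close> to \<open>exp_S1 (- x) * gen x xs\<close>. There the
  exponential turns the leading factor \<open>S_fps x\<close> into
  \<open>sharp_fps x\<close>.\<close>

lemma subst_gen_S_sharp:
  "subst_series (gen x xs) (S_sharp m) = fps_nth (prod_list (map sharp_fps (x # xs))) m"
proof -
  note g0 = grouplikeD(1) [OF grouplike_gen]
  have g1: "fps_nth (gen x xs) (Suc 0) = smult_sym x (S 1)"
    using sharps_nth_1 [of xs] grouplikeD(1) [OF grouplike_sharps [of xs]] by (simp add: gen_nth)
  have "prod_list (map sharp_fps (x # xs)) = exp_S1 (- x) * gen x xs"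
    by (simp add: sharp_fps_def gen_def mult.assoc)
  then have "fps_nth (prod_list (map sharp_fps (x # xs))) m =
      (\<Sum>a\<le>m. smult_sym ((- x) ^ a / fact a) (S 1 ^ a * fps_nth (gen x xs) (m - a)))"
    by (simp add: fps_mult_nth atLeast0AtMost exp_S1_nth)
  also have "\<dots> = (\<Sum>a\<le>m. smult_sym ((- 1) ^ a / fact a)
      (fps_nth (gen x xs) 1 ^ a * fps_nth (gen x xs) (m - a)))"
    by (rule sum.cong) (simp_all add: g1 smult_sym_power power_minus [of x])
  also have "\<dots> = subst_series (gen x xs) (S_sharp m)"
    by (simp add: S_sharp_def lin_opD [OF lin_op_subst_series] subst_series_mult subst_series_power
        subst_series_S g0)
  finally show ?thesis by simp
qed

text \<open>For \<open>gen x xs\<close> on the right, the endomorphism maps the \<open>D0\<close>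
  factor of \<open>S j * G\<close> to a polynomial in components of a product of series
  \<open>sharp_fps\<close>, which lies in \<open>D0\<close> again, and \<open>S j\<close> to a
  component of \<open>gen x xs\<close>.\<close>

lemma iprod_in_D:
  assumes F: "F \<in> D n k" and G: "G \<in> D n k"
  shows "iprod F G \<in> D n k"
  using G
proof (induction rule: D_induct)
  case subspace
  show ?case
    using subspace_D [of n k] by (simp add: sym.subspace_def lin_opD [OF lin_op_iprod_right])
next
  case (gen x xs)
  let ?g = "gen x xs" and ?h = "prod_list (map sharp_fps (x # xs))"
  note g0 = grouplikeD(1) [OF grouplike_gen]
  have "subst_series ?g F \<in> D n k"
    using F
  proof (induction rule: D_cases)
    case subspace
    show ?case
      using subspace_D [of n k] by (simp add: sym.subspace_def lin_opD [OF lin_op_subst_series])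
  next
    case (basis j G)
    then obtain G' where G': "G' \<in> Sym_hom (n - j)" "G = subst_series (sharp_fps 1) G'"
      by (auto simp: D0_eq)
    have "subst_series ?g G = subst_series ?h G'"
      unfolding G'
      by (rule subst_series_comp)
        (simp_all only: g0 grouplikeD(1) [OF grouplike_sharps] grouplikeD(1) [OF grouplike_sharp_fps]
          sharp_fps_1_nth subst_gen_S_sharp S_sharp_0)
    also have "\<dots> \<in> D0 (n - j)"
      by (rule subst_series_in_D0 [OF grouplikeD(1) [OF grouplike_sharps] sharps_nth_in_D0 G'(1)])
    finally have "subst_series ?g G \<in> D0 (n - j)" .
    \<comment> \<open>This component involves only \<open>S a\<close> with \<open>a \<le> j\<close>,
      and \<open>j \<le> k\<close>.\<close>
    moreover have "fps_nth ?g j \<in> D j k"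
      unfolding gen_nth using basis(1)
      by (intro sym.subspace_sum [OF subspace_D] sym.subspace_scale [OF subspace_D]
          S_mult_in_D [OF _ sharps_nth_in_D0]) auto
    ultimately show ?case
      using D_mult_D0 [of "fps_nth ?g j" j k _ "n - j"] basis
      by (simp add: subst_series_mult [OF g0] subst_series_S [OF g0])
  qed
  then show ?case
    using iprod_grouplike [OF grouplike_gen subsetD [OF D_subset_Sym_hom F]] by simp
qed

section \<open>Powers of \<open>S 1\<close> in \<open>D n k\<close> and the unit\<close>

lemma exp_S1_mult: "exp_S1 s * exp_S1 t = exp_S1 (s + t)"
proof (rule fps_ext)
  fix n
  have "fps_nth (exp_S1 s * exp_S1 t) n =
      smult_sym (\<Sum>a\<le>n. t ^ (n - a) / fact (n - a) * (s ^ a / fact a)) (S 1 ^ n)"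
    by (simp add: fps_mult_nth atLeast0AtMost exp_S1_nth sym.scale_sum_left flip: power_add)
  also have "(\<Sum>a\<le>n. t ^ (n - a) / fact (n - a) * (s ^ a / fact a)) = (s + t) ^ n / fact n"
    unfolding binomial_ring sum_divide_distrib
    by (rule sum.cong) (simp_all add: binomial_fact mult.commute)
  finally show "fps_nth (exp_S1 s * exp_S1 t) n = fps_nth (exp_S1 (s + t)) n"
    by (simp add: exp_S1_nth)
qed

lemma S_eq_sum: "S n = (\<Sum>a\<le>n. fps_nth (exp_S1 1) a * S_sharp (n - a))"
proof -
  have "exp_S1 0 = 1"
    by (rule fps_ext) (auto simp: exp_S1_nth power_0_left)
  then have "S_fps 1 = exp_S1 1 * sharp_fps 1"
    by (simp add: sharp_fps_def exp_S1_mult flip: mult.assoc)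
  then have "fps_nth (S_fps 1) n = fps_nth (exp_S1 1 * sharp_fps 1) n" by simp
  then show ?thesis
    by (simp add: S_fps_nth fps_mult_nth atLeast0AtMost sharp_fps_1_nth)
qed

text \<open>Expand \<open>S a\<close> by \<open>S_eq_sum\<close> and solve for the term with the
  highest power of \<open>S 1\<close>. The other terms are lower powers times elements of
  \<open>D0\<close>, covered by the induction.\<close>

lemma exp_S1_mult_in_D:
  assumes "H \<in> D0 m"
  shows "fps_nth (exp_S1 1) a * H \<in> D (a + m) a"
  using assms
proof (induction a arbitrary: m H rule: less_induct)
  case (less a)
  let ?E = "fps_nth (exp_S1 1)"
  have "S a * H = (\<Sum>b<a. ?E b * (S_sharp (a - b) * H)) + ?E a * H"
    by (subst S_eq_sum)
      (simp add: distrib_right sum_distrib_right mult.assoc flip: lessThan_Suc_atMost)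
  moreover have "?E b * (S_sharp (a - b) * H) \<in> D (a + m) a" if "b < a" for b
    using less.IH [OF that D0_mult [OF S_sharp_in_D0 less.prems, of "a - b"]] D_mono [of b a] that
    by auto
  then have "S a * H - (\<Sum>b<a. ?E b * (S_sharp (a - b) * H)) \<in> D (a + m) a"
    using less.prems by (intro sym.subspace_diff [OF subspace_D] sym.subspace_sum [OF subspace_D])
      (auto intro: S_mult_in_D)
  ultimately show ?case by simp
qed

lemma S1_power_mult_in_D:
  assumes "H \<in> D0 m" "a \<le> k" "n = a + m"
  shows "S 1 ^ a * H \<in> D n k"
proof -
  have "smult_sym (fact a) (fps_nth (exp_S1 1) a * H) \<in> D (a + m) a"
    by (intro sym.subspace_scale [OF subspace_D] exp_S1_mult_in_D assms)
  then show ?thesis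
    using D_mono [OF assms(2)] assms(3) by (auto simp: exp_S1_nth)
qed

lemma D_unit_in_D: "D_unit n k \<in> D n k"
  unfolding D_unit_def
  by (intro sym.subspace_sum [OF subspace_D] sym.subspace_scale [OF subspace_D]
      S1_power_mult_in_D [OF S_sharp_in_D0]) auto

section \<open>Characters\<close>

primrec del_list :: "nat \<Rightarrow> nat list \<Rightarrow> sym"
  where
    "del_list m [] = 0"
  | "del_list m (j # J) = (if m \<le> j then S (j - m) * Sb J else 0) + S j * del_list m J"

text \<open>\<open>del m\<close> is the derivation with \<open>S_n \<mapsto> S_(n-m)\<close>; this makes sense for \<open>m > 0\<close> only,
  because \<open>S_0\<close> is the unit.\<close>

definition del :: "nat \<Rightarrow> sym \<Rightarrow> sym"
  where "del m = lin_ext (\<lambda>I. del_list m (parts I))"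

lemma lin_op_del: "lin_op (del m)"
  by (simp add: del_def lin_op_lin_ext)

lemma del_Sb:
  assumes "m > 0"
  shows "del m (Sb J) = del_list m J"
proof -
  have "del_list m (filter ((<) 0) J) = del_list m J" for J
    using assms by (induction J) (auto simp: Sb_drop_zeros)
  then show ?thesis
    unfolding del_def by (rule lin_ext_Sb_list)
qed

lemma del_S: "m > 0 \<Longrightarrow> del m (S j) = (if m \<le> j then S (j - m) else 0)"
  using del_Sb [of m "[j]"] by simp

lemma del_1 [simp]: "m > 0 \<Longrightarrow> del m 1 = 0"
  using del_Sb [of m "[]"] by simp

lemma del_mult:
  assumes m: "m > 0"
  shows "del m (F * G) = del m F * G + F * del m G"
proof (rule lin_op_eqI [where f = "\<lambda>F. del m (F * G)"])
  show "lin_op (\<lambda>F. del m (F * G))"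
    by (rule lin_op_compose [OF lin_op_del lin_op_mult_right])
  show "lin_op (\<lambda>F. del m F * G + F * del m G)"
    by (rule lin_opI) (simp_all add: lin_opD [OF lin_op_del] distrib_right sym.scale_right_distrib)
  fix J :: "nat list"
  show "del m (Sb J * G) = del m (Sb J) * G + Sb J * del m G"
  proof (rule lin_op_eqI [where f = "\<lambda>G. del m (Sb J * G)"])
    show "lin_op (\<lambda>G. del m (Sb J * G))"
      by (rule lin_op_compose [OF lin_op_del lin_op_mult_left])
    show "lin_op (\<lambda>G. del m (Sb J) * G + Sb J * del m G)"
      by (rule lin_opI) (simp_all add: lin_opD [OF lin_op_del] distrib_left sym.scale_right_distrib)
    have "del_list m (J @ K) = del_list m J * Sb K + Sb J * del_list m K" for K
      by (induction J) (simp_all add: distrib_left distrib_right mult.assoc)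
    then show "del m (Sb J * Sb K) = del m (Sb J) * Sb K + Sb J * del m (Sb K)" for K
      by (simp add: del_Sb m flip: Sb_simps(3))
  qed
qed

lemma del_eq_0:
  assumes "F \<in> Sym_hom n" "n < m"
  shows "del m F = 0"
  using assms(1)
proof (induction rule: Sym_hom_induct)
  case subspace
  show ?case by (simp add: sym.subspace_def lin_opD [OF lin_op_del])
next
  case (basis J)
  have "sum_list J < m \<Longrightarrow> del_list m J = 0"
    by (induction J) auto
  with basis assms(2) show ?case by (simp add: del_Sb)
qed

text \<open>For \<open>m > n\<close> the difference \<open>n - m\<close> is 0, but the derivative
  vanishes and so lies in \<open>Sym_hom 0\<close> as well.\<close>

lemma del_in_Sym_hom:
  assumes "F \<in> Sym_hom n" "m > 0"
  shows "del m F \<in> Sym_hom (n - m)"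
proof (cases "m \<le> n")
  case False
  then show ?thesis
    using del_eq_0 [OF assms(1), of m] sym.subspace_0 [OF subspace_Sym_hom] by simp
next
  case True
  show ?thesis
    using assms(1)
  proof (induction rule: Sym_hom_induct)
    case subspace
    show ?case
      using subspace_Sym_hom [of "n - m"] by (simp add: sym.subspace_def lin_opD [OF lin_op_del])
  next
    case (basis J)
    have "del_list m J \<in> Sym_hom (sum_list J - m)"
    proof (induction J)
      case Nil
      show ?case using sym.subspace_0 [OF subspace_Sym_hom] by simp
    next
      case (Cons j J)
      have "S (j - m) * Sb J \<in> Sym_hom (j + sum_list J - m)" if "m \<le> j"
        using Sym_hom_mult [OF S_in_Sym_hom Sb_in_Sym_hom, of "j - m" J] that by simp
      moreover have "S j * del_list m J \<in> Sym_hom (j + sum_list J - m)"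
      proof (cases "m \<le> sum_list J")
        case True
        then show ?thesis using Sym_hom_mult [OF S_in_Sym_hom Cons, of j] by simp
      next
        case False
        then have "del_list m J = 0"
          using del_eq_0 [OF Sb_in_Sym_hom, of J m] assms(2) by (simp add: del_Sb)
        then show ?thesis using sym.subspace_0 [OF subspace_Sym_hom] by simp
      qed
      ultimately show ?case
        by (auto intro: sym.subspace_add [OF subspace_Sym_hom])
    qed
    with basis assms(2) show ?case by (simp add: del_Sb)
  qed
qed

text \<open>\<open>chi I\<close> is the commutative image followed by the scalar product with the power sum \<open>p_I\<close>,
  which is adjoint to multiplication and acts as the iterated derivation.\<close>

primrec chi :: "nat list \<Rightarrow> sym \<Rightarrow> complex"
  where
    "chi [] F = Poly_Mapping.lookup F 0"
  | "chi (m # I) F = chi I (del m F)"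

lemma chi_linear:
  "chi I (F + G) = chi I F + chi I G" "chi I (smult_sym c F) = c * chi I F" "chi I 0 = 0"
  by (induction I arbitrary: F G) (simp_all add: lookup_add lin_opD [OF lin_op_del])

lemma chi_sum: "chi I (sum f X) = (\<Sum>x\<in>X. chi I (f x))"
  by (induction X rule: infinite_finite_induct) (simp_all add: chi_linear)

lemma chi_S:
  "0 \<notin> set I \<Longrightarrow> chi I (S (sum_list I)) = 1"
proof (induction I)
  case (Cons m I)
  then show ?case by (simp add: del_S)
qed (simp add: lookup_one)

text \<open>The coefficients of the equation \<open>del m g = \<alpha> m X^m g\<close>, where
  \<open>X\<close> is the variable of the series: up to the shift in degree, \<open>g\<close> is a
  common eigenvector of all derivations.\<close>

definition del_eigen :: "sym fps \<Rightarrow> (nat \<Rightarrow> complex) \<Rightarrow> bool"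
  where "del_eigen g \<alpha> \<longleftrightarrow> (\<forall>m>0. \<forall>n. del m (fps_nth g n) =
    smult_sym (\<alpha> m) (if m \<le> n then fps_nth g (n - m) else 0))"

lemma del_eigenD:
  "del_eigen g \<alpha> \<Longrightarrow> m > 0 \<Longrightarrow>
    del m (fps_nth g n) = smult_sym (\<alpha> m) (if m \<le> n then fps_nth g (n - m) else 0)"
  by (simp add: del_eigen_def)

lemma sum_shift_down:
  fixes f :: "nat \<Rightarrow> 'a::comm_monoid_add"
  shows "(\<Sum>a\<le>n. if m \<le> a then f (a - m) else 0) = (if m \<le> n then \<Sum>a\<le>n - m. f a else 0)"
proof -
  have "(\<Sum>a\<le>n. if m \<le> a then f (a - m) else 0) = (\<Sum>a\<in>{a. a \<le> n \<and> m \<le> a}. f (a - m))"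
    by (subst sum.inter_filter [symmetric]) (auto intro: sum.cong)
  also have "\<dots> = (if m \<le> n then \<Sum>a\<le>n - m. f a else 0)"
    by (auto intro!: sum.reindex_bij_witness [where i = "\<lambda>a. a + m" and j = "\<lambda>a. a - m"] sum.neutral)
  finally show ?thesis .
qed

text \<open>Leibniz rule: each factor contributes its eigenvalue, and the degree shift can be moved
  from either factor to the product.\<close>

lemma del_eigen_mult:
  assumes g: "del_eigen g \<alpha>" and h: "del_eigen h \<beta>"
  shows "del_eigen (g * h) (\<lambda>m. \<alpha> m + \<beta> m)"
  unfolding del_eigen_def
proof (intro allI impI)
  fix m n :: nat
  assume m: "m > 0"
  let ?g = "fps_nth g" and ?h = "fps_nth h"
  have nth: "fps_nth (g * h) n = (\<Sum>a\<le>n. ?g a * ?h (n - a))" for n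
    by (simp add: fps_mult_nth atLeast0AtMost)
  have "(\<Sum>a\<le>n. (if m \<le> a then ?g (a - m) else 0) * ?h (n - a)) =
      (\<Sum>a\<le>n. if m \<le> a then ?g (a - m) * ?h (n - m - (a - m)) else 0)"
    by (rule sum.cong) auto
  also have "\<dots> = (if m \<le> n then fps_nth (g * h) (n - m) else 0)"
    by (simp add: sum_shift_down [where f = "\<lambda>a. ?g a * ?h (n - m - a)"] nth)
  finally have 1: "(\<Sum>a\<le>n. (if m \<le> a then ?g (a - m) else 0) * ?h (n - a)) =
    (if m \<le> n then fps_nth (g * h) (n - m) else 0)" .
  have "(\<Sum>a\<le>n. ?g a * (if m \<le> n - a then ?h (n - a - m) else 0)) =
      (\<Sum>a\<in>{a. a \<le> n \<and> m \<le> n - a}. ?g a * ?h (n - m - a))"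
    by (rule sum.mono_neutral_cong_right) (auto simp: add.commute)
  also have "\<dots> = (if m \<le> n then fps_nth (g * h) (n - m) else 0)"
    using m by (auto simp: nth intro!: sum.cong sum.neutral)
  finally have 2: "(\<Sum>a\<le>n. ?g a * (if m \<le> n - a then ?h (n - a - m) else 0)) =
    (if m \<le> n then fps_nth (g * h) (n - m) else 0)" .
  have "del m (fps_nth (g * h) n) =
      smult_sym (\<alpha> m) (\<Sum>a\<le>n. (if m \<le> a then ?g (a - m) else 0) * ?h (n - a)) +
      smult_sym (\<beta> m) (\<Sum>a\<le>n. ?g a * (if m \<le> n - a then ?h (n - a - m) else 0))"
    by (simp only: nth lin_opD [OF lin_op_del] del_mult [OF m] del_eigenD [OF g m] del_eigenD [OF h m]
        sum.distrib sym.scale_sum_right smult_sym_mult_left smult_sym_mult_right)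
  then show "del m (fps_nth (g * h) n) =
      smult_sym (\<alpha> m + \<beta> m) (if m \<le> n then fps_nth (g * h) (n - m) else 0)"
    unfolding 1 2 by (simp add: sym.scale_left_distrib)
qed

lemma del_eigen_S_fps: "del_eigen (S_fps x) (\<lambda>m. x ^ m)"
  by (simp add: del_eigen_def S_fps_nth lin_opD [OF lin_op_del] del_S flip: power_add)

lemma del_S1_power:
  assumes "m > 0"
  shows "del m (S 1 ^ n) = (if m = 1 then smult_sym (of_nat n) (S 1 ^ (n - 1)) else 0)"
proof (induction n)
  case (Suc n)
  have "S 1 * smult_sym (of_nat n) (S 1 ^ (n - 1)) = smult_sym (of_nat n) (S 1 ^ n)"
    by (cases n) simp_all
  then show ?case
    using assms Suc by (auto simp: del_mult del_S sym.scale_left_distrib)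
qed (use assms in simp)

lemma del_eigen_exp_S1: "del_eigen (exp_S1 t) (\<lambda>m. if m = 1 then t else 0)"
  unfolding del_eigen_def
proof (intro allI impI)
  fix m n :: nat
  assume m: "m > 0"
  have "t ^ n / fact n * of_nat n = t * (t ^ (n - 1) / fact (n - 1))" if "n > 0"
    using that by (cases n) (simp_all del: of_nat_Suc)
  then show "del m (fps_nth (exp_S1 t) n) = smult_sym (if m = 1 then t else 0)
      (if m \<le> n then fps_nth (exp_S1 t) (n - m) else 0)"
    using m by (cases "n = 0")
      (auto simp: exp_S1_nth lin_opD [OF lin_op_del] del_S1_power [unfolded One_nat_def])
qed

text \<open>The exponential factor contributes \<open>- x\<close> for \<open>m = 1\<close> only and
  cancels the eigenvalue of \<open>S_fps x\<close> there. This is why \<open>del 1\<close>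
  annihilates \<open>D0\<close>.\<close>

lemma del_eigen_sharp_fps: "del_eigen (sharp_fps x) (\<lambda>m. if m = 1 then 0 else x ^ m)"
proof -
  have "(\<lambda>m. (if m = 1 then - x else 0) + x ^ m) = (\<lambda>m. if m = 1 then 0 else x ^ m)"
    by auto
  then show ?thesis
    using del_eigen_mult [OF del_eigen_exp_S1 [of "- x"] del_eigen_S_fps [of x]]
    by (simp only: sharp_fps_def)
qed

lemma del_eigen_gen: "\<exists>\<alpha>. del_eigen (gen x xs) \<alpha>"
proof -
  have "del_eigen 1 (\<lambda>_. 0)"
  proof -
    have "del m (fps_nth 1 n) = 0" if "m > 0" for m n
      using that by (cases "n = 0") (simp_all add: lin_opD [OF lin_op_del])
    then show ?thesis by (simp add: del_eigen_def)
  qed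
  then have "\<exists>\<alpha>. del_eigen (prod_list (map sharp_fps xs)) \<alpha>"
    by (induction xs) (auto intro: del_eigen_mult del_eigen_sharp_fps)
  then show ?thesis
    unfolding gen_def by (blast intro: del_eigen_mult del_eigen_S_fps)
qed

text \<open>Both sides obey the Leibniz rule relative to the endomorphism, and they agree at the
  generators by the eigenvalue equation.\<close>

lemma del_subst_series:
  assumes g0: "fps_nth g 0 = 1" and g: "del_eigen g \<alpha>" and m: "m > 0"
  shows "del m (subst_series g F) = smult_sym (\<alpha> m) (subst_series g (del m F))"
proof (rule lin_op_eqI [where f = "\<lambda>F. del m (subst_series g F)"])
  show "lin_op (\<lambda>F. del m (subst_series g F))"
    by (rule lin_op_compose [OF lin_op_del lin_op_subst_series])
  show "lin_op (\<lambda>F. smult_sym (\<alpha> m) (subst_series g (del m F)))"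
    by (rule lin_opI) (simp_all add: lin_opD [OF lin_op_del] lin_opD [OF lin_op_subst_series]
        sym.scale_right_distrib mult.commute)
  show "del m (subst_series g (Sb J)) = smult_sym (\<alpha> m) (subst_series g (del m (Sb J)))" for J
  proof (induction J)
    case Nil
    show ?case using m by (simp add: subst_series_1 g0 lin_opD [OF lin_op_subst_series])
  next
    case (Cons j J)
    then show ?case
      using m by (simp add: subst_series_mult [OF g0] del_mult del_S subst_series_S [OF g0] del_eigenD [OF g m]
          lin_opD [OF lin_op_subst_series] sym.scale_right_distrib)
  qed
qed

text \<open>Moving the derivations past the endomorphism produces one eigenvalue for each part of
  \<open>I\<close>; what remains is a constant term, which the endomorphism preserves.\<close>

lemma chi_subst_series:
  assumes g: "grouplike g" "del_eigen g \<alpha>"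
  shows "0 \<notin> set I \<Longrightarrow> F \<in> Sym_hom n \<Longrightarrow>
    chi I (subst_series g F) = prod_list (map \<alpha> I) * chi I F"
proof (induction I arbitrary: F n)
  case Nil
  then have hom: "subst_series g F \<in> Sym_hom n"
    using g by (auto intro: subst_series_in_Sym_hom grouplikeD)
  show ?case
  proof (cases "n = 0")
    case True
    then have F: "F = smult_sym (Poly_Mapping.lookup F 0) 1"
      using Nil Sym_hom_0 by simp
    have "subst_series g F = F"
      by (subst (1 2) F)
        (simp add: lin_opD [OF lin_op_subst_series] subst_series_1 grouplikeD(1) [OF g(1)])
    then show ?thesis by simp
  next
    case False
    then show ?thesis using Nil hom lookup_0_Sym_hom by simp
  qed
next
  case (Cons m I)
  then show ?case
    using del_in_Sym_hom [of F n m]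
    by (simp add: del_subst_series [OF grouplikeD(1) [OF g(1)] g(2)] chi_linear)
qed

lemma chi_grouplike:
  assumes "grouplike g" "del_eigen g \<alpha>" "0 \<notin> set I"
  shows "chi I (fps_nth g (sum_list I)) = prod_list (map \<alpha> I)"
  using chi_subst_series [OF assms S_in_Sym_hom, of "sum_list I"]
  by (simp add: subst_series_S grouplikeD(1) [OF assms(1)] chi_S assms(3))

text \<open>At a component of \<open>gen x xs\<close>, right multiplication is an endomorphism,
  which multiplies \<open>chi I\<close> by the product of the eigenvalues. By
  \<open>chi_grouplike\<close> this product is the value of \<open>chi I\<close> at the
  component.\<close>

lemma chi_iprod:
  assumes I: "0 \<notin> set I" "sum_list I = n" and F: "F \<in> Sym_hom n" and G: "G \<in> D n k"
  shows "chi I (iprod F G) = chi I F * chi I G"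
  using G
proof (induction rule: D_induct)
  case subspace
  show ?case
    by (simp add: sym.subspace_def chi_linear lin_opD [OF lin_op_iprod_right] distrib_left)
next
  case (gen x xs)
  obtain \<alpha> where "del_eigen (gen x xs) \<alpha>"
    using del_eigen_gen by blast
  then show ?case
    using chi_grouplike [OF grouplike_gen _ I(1)] chi_subst_series [OF grouplike_gen _ I(1) F] I(2)
    by (simp add: iprod_grouplike [OF grouplike_gen F])
qed

text \<open>At the components of \<open>gen x xs\<close> the value is a product of eigenvalues over
  the parts, whose order is irrelevant.\<close>

lemma chi_cong_mset:
  assumes "0 \<notin> set I" "sum_list I = n" "mset I = mset J" and F: "F \<in> D n k"
  shows "chi I F = chi J F"
  using F
proof (induction rule: D_induct)
  case subspace
  show ?case by (simp add: sym.subspace_def chi_linear)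
next
  case (gen x xs)
  obtain \<alpha> where \<alpha>: "del_eigen (gen x xs) \<alpha>"
    using del_eigen_gen by blast
  have J: "0 \<notin> set J" "sum_list J = n"
    using assms mset_eq_setD [OF assms(3)] by (simp_all flip: sum_mset_sum_list)
  have "prod_list (map \<alpha> I) = prod_list (map \<alpha> J)"
    using assms(3) by (metis mset_map prod_mset_prod_list)
  then show ?case
    using chi_grouplike [OF grouplike_gen \<alpha> assms(1)] chi_grouplike [OF grouplike_gen \<alpha> J(1)]
      assms(2) J(2) by simp
qed

section \<open>Triangularity of right internal multiplication\<close>

definition long :: "nat \<Rightarrow> sym set"
  where "long l = {F. Poly_Mapping.keys F \<subseteq> {I. l \<le> length (parts I)}}"

lemma subspace_long: "sym.subspace (long l)"
  by (simp add: long_def subspace_keys)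

lemma long_mult:
  assumes "F \<in> long a" "G \<in> long b"
  shows "F * G \<in> long (a + b)"
  using assms keys_mult [of F G] by (fastforce simp: long_def plus_composition.rep_eq)

lemma Sb_in_long: "0 \<notin> set J \<Longrightarrow> Sb J \<in> long (length J)"
  by (auto simp: long_def Sb_positive Composition_inverse)

lemma Sym_hom_subset_long:
  assumes "n > 0"
  shows "Sym_hom n \<subseteq> long 1"
proof
  fix F
  assume "F \<in> Sym_hom n"
  then have "parts I \<noteq> []" if "I \<in> Poly_Mapping.keys F" for I
    using that assms by (auto simp: Sym_hom_def)
  then show "F \<in> long 1"
    by (auto simp: long_def Suc_le_eq)
qed

text \<open>A product of at least two generators in degree \<open>m\<close> has all its parts below
  \<open>m\<close> and is annihilated by \<open>del m\<close>. Thus \<open>chi [m]\<close> reads off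
  the coefficient of \<open>S m\<close>.\<close>

lemma leading_term_S:
  assumes "G \<in> Sym_hom m" "m > 0"
  shows "G - smult_sym (chi [m] G) (S m) \<in> long 2"
  using assms(1)
proof (induction rule: Sym_hom_induct)
  case subspace
  have eq: "F + G - smult_sym (chi [m] F + chi [m] G) (S m) =
      (F - smult_sym (chi [m] F) (S m)) + (G - smult_sym (chi [m] G) (S m))"
    "smult_sym c F - smult_sym (c * chi [m] F) (S m) = smult_sym c (F - smult_sym (chi [m] F) (S m))"
    for F G c
    by (simp_all add: sym.scale_left_distrib sym.scale_right_diff_distrib)
  show ?case
    unfolding sym.subspace_def mem_Collect_eq chi_linear eq
    using subspace_long by (auto simp: sym.subspace_def)
next
  case (basis J)
  then obtain j J' where J: "J = j # J'" using assms(2) by (cases J) auto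
  show ?case
  proof (cases "J' = []")
    case True
    then show ?thesis
      using J basis chi_S [of "[m]"] assms(2) sym.subspace_0 [OF subspace_long] by simp
  next
    case False
    then have J': "j < m" "sum_list J' < m" "length J \<ge> 2"
      using J basis by (cases J'; auto)+
    then have "chi [m] (Sb J) = 0"
      using del_eq_0 [OF Sb_in_Sym_hom, of J' m] J assms(2) by (simp add: del_mult del_S)
    moreover have "long (length J) \<subseteq> long 2"
      using J' by (auto simp: long_def)
    ultimately show ?thesis
      using Sb_in_long [OF basis(1)] by auto
  qed
qed

text \<open>Replacing one factor \<open>g_i\<close> by its leading term changes the product by terms
  with at least one additional part.\<close>

lemma leading_term_prod:
  assumes g: "grouplike g" "del_eigen g \<alpha>"
  shows "0 \<notin> set I \<Longrightarrow> prod_list (map (fps_nth g) I) - smult_sym (prod_list (map \<alpha> I)) (Sb I)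
    \<in> long (Suc (length I))"
proof (induction I)
  case Nil
  then show ?case using sym.subspace_0 [OF subspace_long] by simp
next
  case (Cons i I)
  let ?P = "prod_list (map (fps_nth g) I)" and ?Q = "smult_sym (prod_list (map \<alpha> I)) (Sb I)"
  have i: "i > 0" and I: "0 \<notin> set I"
    using Cons.prems by auto
  have chi_i: "chi [i] (fps_nth g i) = \<alpha> i"
    using chi_grouplike [OF g, of "[i]"] i by simp
  have "?P \<in> long (length I)"
    using I
  proof (induction I)
    case (Cons j I)
    have "fps_nth g j \<in> long 1"
      using Cons.prems Sym_hom_subset_long [of j] grouplikeD(2) [OF g(1)] by auto
    then show ?case
      using long_mult [of "fps_nth g j" 1] Cons by simp
  qed (simp add: long_def)
  then have "(fps_nth g i - smult_sym (\<alpha> i) (S i)) * ?P \<in> long (2 + length I)"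
    using leading_term_S [OF grouplikeD(2) [OF g(1)] i] by (intro long_mult) (simp_all only: chi_i)
  moreover have "S i \<in> long 1"
    using Sym_hom_subset_long [OF i] S_in_Sym_hom by auto
  then have "smult_sym (\<alpha> i) (S i) * (?P - ?Q) \<in> long (1 + Suc (length I))"
    using Cons.IH [OF I] by (intro long_mult sym.subspace_scale [OF subspace_long])
  \<comment> \<open>Telescoping: first the head is replaced by its leading term, then the
    tail.\<close>
  moreover have "prod_list (map (fps_nth g) (i # I)) - smult_sym (prod_list (map \<alpha> (i # I))) (Sb (i # I)) =
      (fps_nth g i - smult_sym (\<alpha> i) (S i)) * ?P + smult_sym (\<alpha> i) (S i) * (?P - ?Q)"
    by (simp add: left_diff_distrib right_diff_distrib sym.scale_right_diff_distrib)
  ultimately show ?case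
    using sym.subspace_add [OF subspace_long, of _ "Suc (length (i # I))"] by simp
qed

lemma iprod_in_Sym_hom:
  assumes "F \<in> Sym_hom n" "G \<in> D n k"
  shows "iprod F G \<in> Sym_hom n"
  using assms(2)
proof (induction rule: D_induct)
  case subspace
  show ?case
    using subspace_Sym_hom [of n] by (simp add: sym.subspace_def lin_opD [OF lin_op_iprod_right])
next
  case (gen x xs)
  show ?case
    unfolding iprod_grouplike [OF grouplike_gen assms(1)]
    by (intro subst_series_in_Sym_hom grouplikeD [OF grouplike_gen] assms)
qed

lemma iprod_triangular:
  assumes I: "0 \<notin> set I" "sum_list I = n" and G: "G \<in> D n k"
  shows "iprod (Sb I) G - smult_sym (chi I G) (Sb I) \<in> long (Suc (length I))"
  using G
proof (induction rule: D_induct)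
  case subspace
  have eq: "F + G - smult_sym (chi I F' + chi I G') (Sb I) =
      (F - smult_sym (chi I F') (Sb I)) + (G - smult_sym (chi I G') (Sb I))"
    "smult_sym c F - smult_sym (c * chi I F') (Sb I) = smult_sym c (F - smult_sym (chi I F') (Sb I))"
    for F G F' G' c
    by (simp_all add: sym.scale_left_distrib sym.scale_right_diff_distrib)
  show ?case
    unfolding sym.subspace_def mem_Collect_eq chi_linear lin_opD [OF lin_op_iprod_right] eq
    using subspace_long by (auto simp: sym.subspace_def)
next
  case (gen x xs)
  obtain \<alpha> where \<alpha>: "del_eigen (gen x xs) \<alpha>"
    using del_eigen_gen by blast
  have "Sb I \<in> Sym_hom n"
    using Sb_in_Sym_hom [of I] I by simp
  then show ?case
    using leading_term_prod [OF grouplike_gen \<alpha> I(1)] chi_grouplike [OF grouplike_gen \<alpha> I(1)] I(2)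
    by (simp add: iprod_grouplike [OF grouplike_gen] subst_series_Sb grouplikeD(1) [OF grouplike_gen])
qed

text \<open>\<open>U\<close> and \<open>insert I U\<close> contain with a composition all those of
  \<open>n\<close> with more parts, so by triangularity right multiplication by \<open>G\<close>
  preserves supports in them. Subtracting the diagonal entry at \<open>I\<close> removes
  \<open>I\<close> from the support.\<close>

lemma iprod_peel_off:
  assumes U: "\<And>J K. J \<in> insert I U \<Longrightarrow> sum_list (parts K) = n \<Longrightarrow>
      length (parts J) < length (parts K) \<Longrightarrow> K \<in> U"
    and F: "F \<in> Sym_hom n" "Poly_Mapping.keys F \<subseteq> insert I U" and G: "G \<in> D n k"
  shows "Poly_Mapping.keys (iprod F G - smult_sym (chi (parts I) G) F) \<subseteq> U"
proof -
  let ?X = "{F. Poly_Mapping.keys F \<subseteq> U}"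
  let ?f = "\<lambda>F. iprod F G - smult_sym (chi (parts I) G) F"
  have f: "lin_op ?f"
    by (rule lin_opI) (simp_all add: lin_opD [OF lin_op_iprod_left] sym.scale_right_distrib
        sym.scale_right_diff_distrib mult.commute)
  have "?f (Sb (parts J)) \<in> ?X" if J: "J \<in> Poly_Mapping.keys F" for J
  proof -
    have n: "sum_list (parts J) = n" and JU: "J \<in> insert I U"
      using F J by (auto simp: Sym_hom_def)
    have hom: "Sb (parts J) \<in> Sym_hom n"
      using Sb_in_Sym_hom [of "parts J"] n by simp
    let ?R = "iprod (Sb (parts J)) G - smult_sym (chi (parts J) G) (Sb (parts J))"
    have "?R \<in> Sym_hom n"
      by (intro sym.subspace_diff [OF subspace_Sym_hom] sym.subspace_scale [OF subspace_Sym_hom]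
          iprod_in_Sym_hom [OF _ G] hom)
    then have R: "?R \<in> ?X"
      using iprod_triangular [OF zero_notin_parts n G] U [OF JU]
      by (fastforce simp: Sym_hom_def long_def)
    show ?thesis
    proof (cases "J = I")
      case True
      then show ?thesis using R by simp
    next
      case False
      then have "Sb (parts J) \<in> ?X"
        using JU by (auto simp: Sb_positive parts_inverse)
      then have "?R + smult_sym (chi (parts J) G - chi (parts I) G) (Sb (parts J)) \<in> ?X"
        by (intro sym.subspace_add [OF subspace_keys] sym.subspace_scale [OF subspace_keys] R)
      then show ?thesis by (simp add: sym.scale_left_diff_distrib)
    qed
  qed
  then have "(\<Sum>J\<in>Poly_Mapping.keys F. smult_sym (Poly_Mapping.lookup F J) (?f (Sb (parts J)))) \<in> ?X"
    by (intro sym.subspace_sum [OF subspace_keys] sym.subspace_scale [OF subspace_keys])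
  also have "(\<Sum>J\<in>Poly_Mapping.keys F. smult_sym (Poly_Mapping.lookup F J) (?f (Sb (parts J)))) = ?f F"
    using arg_cong [OF sym_expansion_Sb [of F], of ?f] by (simp only: lin_opD [OF f])
  finally show ?thesis by simp
qed

section \<open>The characters of \<open>D_n^(k)\<close>\<close>

lemma del_S_sharp:
  "m > 0 \<Longrightarrow> del m (S_sharp n) = (if m \<noteq> 1 \<and> m \<le> n then S_sharp (n - m) else 0)"
  using del_eigenD [OF del_eigen_sharp_fps [of 1], of m n] by (simp add: sharp_fps_1_nth)

lemma del_1_D0: "G \<in> D0 m \<Longrightarrow> del 1 G = 0"
proof (induction rule: D0_induct)
  case subspace
  show ?case by (simp add: sym.subspace_def lin_opD [OF lin_op_del])
next
  case (basis J)
  show ?case by (induction J) (simp_all add: del_mult del_S_sharp)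
qed

text \<open>\<open>chi\<close> applies its derivations from the left of the list. With the ones in
  front, \<open>del 1\<close> acts before all others, on products of a power of \<open>S 1\<close>
  or some \<open>S j\<close> with an element of \<open>D0\<close>; the second factor is constant for
  \<open>del 1\<close>.\<close>

definition ones_first :: "nat list \<Rightarrow> nat list"
  where "ones_first I = replicate (count (mset I) 1) 1 @ filter (\<lambda>i. i \<noteq> 1) I"

lemma mset_ones_first: "mset (ones_first I) = mset I"
proof -
  have "mset I = filter_mset (\<lambda>i. i = 1) (mset I) + filter_mset (\<lambda>i. i \<noteq> 1) (mset I)"
    by (rule multiset_partition)
  then show ?thesis
    by (simp add: ones_first_def filter_eq_replicate_mset)
qed

lemma sum_list_ones_first: "count (mset I) 1 + sum_list (filter (\<lambda>i. i \<noteq> 1) I) = sum_list I"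
proof -
  have "sum_list (ones_first I) = sum_list I"
    by (metis mset_ones_first sum_mset_sum_list)
  then show ?thesis
    by (simp add: ones_first_def sum_list_replicate)
qed

lemma chi_replicate: "chi (replicate a 1 @ I) F = chi I ((del 1 ^^ a) F)"
  by (induction a arbitrary: F) (simp_all add: funpow_swap1)

lemma chi_ones_first:
  assumes "0 \<notin> set I" "sum_list I = n" "F \<in> D n k"
  shows "chi I F = chi (filter (\<lambda>i. i \<noteq> 1) I) ((del 1 ^^ count (mset I) 1) F)"
proof -
  have "chi I F = chi (ones_first I) F"
    using assms by (intro chi_cong_mset [where n = n and k = k]) (simp_all add: mset_ones_first)
  then show ?thesis by (simp only: ones_first_def chi_replicate)
qed

lemma del_1_funpow_mult: "del 1 G = 0 \<Longrightarrow> (del 1 ^^ a) (F * G) = (del 1 ^^ a) F * G"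
  by (induction a) (simp_all add: del_mult)

lemma del_1_funpow_linear:
  "(del 1 ^^ a) 0 = 0"
  "(del 1 ^^ a) (smult_sym c F) = smult_sym c ((del 1 ^^ a) F)"
  "(del 1 ^^ a) (sum f X) = (\<Sum>x\<in>X. (del 1 ^^ a) (f x))"
  by (induction a) (simp_all add: lin_opD [OF lin_op_del])

lemma del_1_funpow_S: "(del 1 ^^ a) (S j) = (if a \<le> j then S (j - a) else 0)"
  by (induction a) (auto simp: del_S lin_opD [OF lin_op_del])

lemma del_1_funpow_S1_power:
  "(del 1 ^^ a) (S 1 ^ i) = (if a \<le> i then smult_sym (fact i / fact (i - a)) (S 1 ^ (i - a)) else 0)"
proof (induction a)
  case (Suc a)
  show ?case
  proof (cases "a < i")
    case True
    then obtain c where c: "i - a = Suc c" "i - Suc a = c" by (metis Suc_diff_Suc)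
    then show ?thesis
      using True Suc del_S1_power [of 1 "Suc c"] by (simp add: lin_opD [OF lin_op_del] del: of_nat_Suc)
  next
    case False
    then show ?thesis
      using Suc by (cases "a = i") (simp_all add: lin_opD [OF lin_op_del])
  qed
qed simp

text \<open>The more than \<open>k\<close> derivations \<open>del 1\<close> pass by the
  \<open>D0\<close> factor of \<open>S j * G\<close> and annihilate \<open>S j\<close>, as
  \<open>j \<le> k\<close>.\<close>

lemma chi_eq_0:
  assumes I: "0 \<notin> set I" "sum_list I = n" "count (mset I) 1 > k" and F: "F \<in> D n k"
  shows "chi I F = 0"
  using F
proof (induction rule: D_cases)
  case subspace
  show ?case by (simp add: sym.subspace_def chi_linear)
next
  case (basis j G)
  then have "S j * G \<in> D n k"
    by (intro S_mult_in_D) auto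
  then show ?case
    using basis I
    by (simp add: chi_ones_first [OF I(1,2)] del_1_funpow_mult [OF del_1_D0] del_1_funpow_S
        chi_linear del: One_nat_def)
qed

text \<open>Derivations other than \<open>del 1\<close> leave powers of \<open>S 1\<close> alone, so
  the positive power survives until the constant term is taken.\<close>

lemma chi_S1_power_mult:
  "0 \<notin> set I \<Longrightarrow> 1 \<notin> set I \<Longrightarrow> c > 0 \<Longrightarrow> X \<in> Sym_hom r \<Longrightarrow> chi I (S 1 ^ c * X) = 0"
proof (induction I arbitrary: X r)
  case Nil
  then show ?case
    using lookup_0_Sym_hom [OF Sym_hom_mult [OF S1_power_in_Sym_hom, of X r c]] by simp
next
  case (Cons m I)
  then show ?case
    using del_in_Sym_hom [of X r m] by (simp add: del_mult del_S1_power [unfolded One_nat_def])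
qed

lemma chi_S_sharp:
  "0 \<notin> set I \<Longrightarrow> 1 \<notin> set I \<Longrightarrow> chi I (S_sharp (sum_list I)) = 1"
  by (induction I) (simp_all add: del_S_sharp lookup_one)

text \<open>Let \<open>b\<close> be the number of ones. Applying \<open>del 1\<close> to the
  summands \<open>b\<close> times kills those with \<open>i < b\<close> and leaves a positive power
  of \<open>S 1\<close> for \<open>i > b\<close>, where the remaining character vanishes. For
  \<open>i = b\<close> the factorials cancel.\<close>

lemma chi_D_unit:
  assumes I: "0 \<notin> set I" "sum_list I = n" "count (mset I) 1 \<le> k"
  shows "chi I (D_unit n k) = 1"
proof -
  let ?b = "count (mset I) 1" and ?I = "filter (\<lambda>i. i \<noteq> 1) I"
  have I': "0 \<notin> set ?I" "1 \<notin> set ?I" using I by auto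
  have sum: "?b + sum_list ?I = n"
    using sum_list_ones_first [of I] I by simp
  have summand: "chi ?I ((del 1 ^^ ?b) (smult_sym (1 / fact i) (S 1 ^ i * S_sharp (n - i)))) =
      (if i = ?b then 1 else 0)" if "i \<le> min k n" for i
  proof -
    have "(del 1 ^^ ?b) (S 1 ^ i * S_sharp (n - i)) = (del 1 ^^ ?b) (S 1 ^ i) * S_sharp (n - i)"
      by (rule del_1_funpow_mult [OF del_1_D0 [OF S_sharp_in_D0]])
    moreover have "chi ?I (S 1 ^ (i - ?b) * S_sharp (n - i)) = 0" if "i > ?b"
      using that by (intro chi_S1_power_mult [OF I' _ S_sharp_in_Sym_hom]) auto
    moreover have "chi ?I (S_sharp (n - ?b)) = 1"
      using chi_S_sharp [OF I'] sum by (metis add_diff_cancel_left')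
    ultimately show ?thesis
      by (cases "i = ?b") (simp_all add: del_1_funpow_linear del_1_funpow_S1_power chi_linear del: One_nat_def)
  qed
  have "chi I (D_unit n k) = (\<Sum>i\<le>min k n. if i = ?b then 1 else 0)"
    by (simp only: chi_ones_first [OF I(1,2) D_unit_in_D])
      (simp only: D_unit_def del_1_funpow_linear(3) chi_sum, rule sum.cong, simp_all only: summand atMost_iff)
  also have "\<dots> = 1"
    using I sum by simp
  finally show ?thesis .
qed

text \<open>A derivation \<open>del m\<close> maps each of the generators \<open>S_1, S_2^\<sharp>, S_3^\<sharp>, \<dots>\<close> to another one, to \<open>0\<close> or,
  if the degree is \<open>m\<close>, to \<open>1\<close>. So the constant term of an iterated derivative of a product of \<open>l\<close>
  generators is zero for fewer than \<open>l\<close> derivations, and for \<open>l\<close> of them unless they match the degrees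
  of the factors.\<close>

definition U :: "nat \<Rightarrow> sym"
  where "U j = (if j = 1 then S 1 else S_sharp j)"

definition U_prod :: "nat list \<Rightarrow> sym"
  where "U_prod J = prod_list (map U J)"

lemma U_prod_simps [simp]: "U_prod [] = 1" "U_prod (j # J) = U j * U_prod J"
  by (simp_all add: U_prod_def)

lemma U_0 [simp]: "U 0 = 1"
  by (simp add: U_def)

text \<open>\<open>m = j\<close> gives \<open>U 0 = 1\<close>. Otherwise two cases are excluded:
  \<open>m = 1\<close>, since \<open>del 1\<close> annihilates \<open>S_sharp j\<close>, and
  \<open>j - m = 1\<close>, since \<open>S_sharp 1 = 0\<close> whereas \<open>U 1\<close> is
  \<open>S 1\<close>.\<close>

definition reduces :: "nat \<Rightarrow> nat \<Rightarrow> bool"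
  where "reduces m j \<longleftrightarrow> m = j \<or> m \<noteq> 1 \<and> m < j \<and> j - m \<noteq> 1"

lemma del_U: "m > 0 \<Longrightarrow> del m (U j) = (if reduces m j then U (j - m) else 0)"
  by (auto simp: U_def reduces_def del_S del_S_sharp)

text \<open>The nonzero terms of the Leibniz rule, one for each factor that is hit. They form a
  list, not a set, because equal terms count with multiplicity; an exhausted factor stays as an
  entry 0.\<close>

primrec reductions :: "nat \<Rightarrow> nat list \<Rightarrow> nat list list"
  where
    "reductions m [] = []"
  | "reductions m (j # J) =
      (if reduces m j then [(j - m) # J] else []) @ map ((#) j) (reductions m J)"

lemma del_U_prod:
  assumes "m > 0"
  shows "del m (U_prod J) = sum_list (map U_prod (reductions m J))"
proof (induction J)
  case (Cons j J)
  have "U j * sum_list (map U_prod Js) = sum_list (map (U_prod \<circ> (#) j) Js)" for Js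
    by (induction Js) (simp_all add: distrib_left)
  then show ?case
    using Cons assms by (simp add: del_mult del_U)
qed (use assms in simp)

lemma chi_U_prod_Cons:
  assumes "m > 0"
  shows "chi (m # I) (U_prod J) = sum_list (map (\<lambda>K. chi I (U_prod K)) (reductions m J))"
proof -
  have "chi I (sum_list (map U_prod Js)) = sum_list (map (\<lambda>K. chi I (U_prod K)) Js)" for Js
    by (induction Js) (simp_all add: chi_linear)
  then show ?thesis using assms by (simp add: del_U_prod)
qed

lemma reductionsD:
  "K \<in> set (reductions m J) \<Longrightarrow> \<exists>xs j ys. J = xs @ j # ys \<and> K = xs @ (j - m) # ys \<and> m \<le> j"
proof (induction J arbitrary: K)
  case (Cons j J)
  then consider "K = (j - m) # J" "reduces m j" | K' where "K = j # K'" "K' \<in> set (reductions m J)"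
    by (auto split: if_splits)
  then show ?case
  proof cases
    case 1
    then show ?thesis
      by (intro exI [of _ "[]"] exI [of _ j] exI [of _ J]) (auto simp: reduces_def)
  next
    case 2
    then obtain xs i ys where "J = xs @ i # ys" "K' = xs @ (i - m) # ys" "m \<le> i"
      using Cons.IH by blast
    with 2 show ?thesis
      by (intro exI [of _ "j # xs"] exI [of _ i] exI [of _ ys]) simp
  qed
qed simp

lemma sum_list_in_Nats: "(\<And>x. x \<in> set xs \<Longrightarrow> x \<in> \<nat>) \<Longrightarrow> sum_list xs \<in> (\<nat> :: complex set)"
  by (induction xs) auto

lemma U_prod_in_Sym_hom: "U_prod J \<in> Sym_hom (sum_list J)"
proof (induction J)
  case (Cons j J)
  have "U j \<in> Sym_hom j"
    using S_in_Sym_hom [of 1] by (simp add: U_def S_sharp_in_Sym_hom)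
  with Cons show ?case by (simp add: Sym_hom_mult)
qed simp

lemma U_prod_eq_1: "\<forall>j\<in>set J. j = 0 \<Longrightarrow> U_prod J = 1"
  by (induction J) auto

text \<open>The value counts the sequences of reductions down to a list of zeros. Being natural
  numbers, such values cannot cancel in a sum.\<close>

lemma chi_U_prod_in_Nats: "0 \<notin> set I \<Longrightarrow> chi I (U_prod J) \<in> \<nat>"
proof (induction I arbitrary: J)
  case Nil
  then show ?case
    using lookup_0_Sym_hom [OF U_prod_in_Sym_hom, of J] by (cases "sum_list J = 0") (auto simp: U_prod_eq_1 lookup_one)
next
  case (Cons m I)
  then show ?case
    by (auto simp: chi_U_prod_Cons simp del: chi.simps intro!: sum_list_in_Nats)
qed

text \<open>If every derivation hits the first remaining factor, the factors are removed one by one.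
  This contributes a nonzero term, and the others are natural numbers.\<close>

lemma chi_U_prod_self: "0 \<notin> set J \<Longrightarrow> chi J (U_prod J) \<noteq> 0"
proof (induction J)
  case (Cons m J)
  have nz: "x + y \<noteq> 0" if x: "x \<in> \<nat>" "x \<noteq> 0" and y: "y \<in> \<nat>" for x y :: complex
  proof -
    obtain a b where "x = of_nat a" "y = of_nat b"
      using x y by (metis Nats_cases)
    then have "x + y = of_nat (a + b)" "a \<noteq> 0" using x by auto
    then show ?thesis by (simp only: of_nat_eq_0_iff)
  qed
  have m: "m > 0" "0 \<notin> set J"
    using Cons.prems by auto
  let ?r = "sum_list (map (\<lambda>K. chi J (U_prod K)) (map ((#) m) (reductions m J)))"
  have "chi (m # J) (U_prod (m # J)) = chi J (U_prod J) + ?r"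
    unfolding chi_U_prod_Cons [OF m(1)] by (simp add: reduces_def)
  moreover have "?r \<in> \<nat>"
    using m by (intro sum_list_in_Nats) (auto simp del: U_prod_simps intro: chi_U_prod_in_Nats)
  ultimately show ?case
    using nz [OF chi_U_prod_in_Nats Cons.IH] m by simp
qed (simp add: lookup_one)

lemma sum_list_map_nonzero:
  "sum_list (map f xs) \<noteq> (0 :: complex) \<Longrightarrow> \<exists>x\<in>set xs. f x \<noteq> 0"
  by (rule ccontr) (simp cong: map_cong)

lemma chi_U_prod_nonzero:
  "0 \<notin> set I \<Longrightarrow> chi I (U_prod J) \<noteq> 0 \<Longrightarrow> length I \<le> length (filter ((<) 0) J) \<Longrightarrow>
    mset I = mset (filter ((<) 0) J)"
proof (induction I arbitrary: J)
  case (Cons m I)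
  have m: "m > 0" and I: "0 \<notin> set I" using Cons.prems by auto
  then obtain K where K: "K \<in> set (reductions m J)" "chi I (U_prod K) \<noteq> 0"
    using Cons.prems(2) sum_list_map_nonzero unfolding chi_U_prod_Cons [OF m] by blast
  then obtain xs j ys where J: "J = xs @ j # ys" "K = xs @ (j - m) # ys" "m \<le> j"
    using reductionsD by blast
  have "length I \<le> length (filter ((<) 0) K)"
    using Cons.prems(3) J m by (auto split: if_splits)
  then have IH: "mset I = mset (filter ((<) 0) K)"
    by (rule Cons.IH [OF I K(2)])
  then have "length I = length (filter ((<) 0) K)"
    by (metis size_mset)
  \<comment> \<open>Otherwise \<open>K\<close> would have as many positive entries as
    \<open>J\<close>, hence more than \<open>length I\<close>.\<close>
  then have "j = m"
    using Cons.prems(3) J m by (auto split: if_splits)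
  then show ?case
    using IH J m by simp
next
  case Nil
  then have "sum_list J = 0"
    using lookup_0_Sym_hom [OF U_prod_in_Sym_hom, of J] by (metis chi.simps(1) gr0I)
  then show ?case by (simp add: filter_empty_conv)
qed

lemma U_prod_in_D:
  assumes "sum_list I = n" "count (mset I) 1 \<le> k"
  shows "U_prod (ones_first I) \<in> D n k"
proof -
  let ?I = "filter (\<lambda>i. i \<noteq> 1) I"
  have "map U ?I = map S_sharp ?I"
    by (simp add: U_def)
  then have "U_prod (ones_first I) = S 1 ^ count (mset I) 1 * prod_list (map S_sharp ?I)"
    by (simp add: U_prod_def ones_first_def U_def map_replicate_const prod_list_replicate
        flip: One_nat_def del: map_eq_conv)
  then show ?thesis
    using S1_power_mult_in_D [OF sharps_in_D0 assms(2)] sum_list_ones_first [of I] assms(1) by metis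
qed

text \<open>Compare the values at the product of generators for the longer list: its own character
  is nonzero there, hence so is the other one, and \<open>chi_U_prod_nonzero\<close> forces the same
  parts.\<close>

lemma chi_separates:
  assumes I: "0 \<notin> set I" "sum_list I = n" "count (mset I) 1 \<le> k"
    and J: "0 \<notin> set J" "sum_list J = n" "count (mset J) 1 \<le> k"
    and eq: "\<And>F. F \<in> D n k \<Longrightarrow> chi I F = chi J F"
  shows "mset I = mset J"
proof -
  have *: "mset I = mset J"
    if I: "0 \<notin> set I" "sum_list I = n" "count (mset I) 1 \<le> k"
    and J: "0 \<notin> set J" "sum_list J = n" "count (mset J) 1 \<le> k"
    and eq: "\<And>F. F \<in> D n k \<Longrightarrow> chi I F = chi J F" and le: "length I \<le> length J"
    for I J
  proof -
    let ?J = "ones_first J"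
    have mset: "mset ?J = mset J" by (rule mset_ones_first)
    have 0: "0 \<notin> set ?J"
      using J mset_eq_setD [OF mset] by simp
    then have filter: "filter ((<) 0) ?J = ?J"
      by (metis (mono_tags, lifting) filter_True gr0I)
    have UD: "U_prod ?J \<in> D n k"
      by (rule U_prod_in_D [OF J(2,3)])
    have "chi I (U_prod ?J) = chi ?J (U_prod ?J)"
      using eq [OF UD] chi_cong_mset [OF J(1,2) mset [symmetric] UD] by simp
    then have "chi I (U_prod ?J) \<noteq> 0"
      using chi_U_prod_self [OF 0] by simp
    moreover have "length ?J = length J"
      using mset by (metis size_mset)
    ultimately show ?thesis
      using chi_U_prod_nonzero [OF I(1), of ?J] le mset by (simp add: filter)
  qed
  show ?thesis
    using * [OF I J eq] * [OF J I eq [symmetric]] by (cases "length I \<le> length J") auto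
qed

section \<open>Irreducible representations\<close>

lemma length_le_sum_list: "0 \<notin> set I \<Longrightarrow> length I \<le> sum_list (I :: nat list)"
  by (induction I) auto

lemma finite_compositions: "finite {I. sum_list (parts I) = n}"
proof -
  have "parts ` {I. sum_list (parts I) = n} \<subseteq> {xs. set xs \<subseteq> {..n} \<and> length xs \<le> n}"
    using length_le_sum_list [OF zero_notin_parts] by (auto intro: member_le_sum_list)
  then have "finite (parts ` {I. sum_list (parts I) = n})"
    by (rule finite_subset) (simp add: finite_lists_length_le)
  then show ?thesis
    by (rule finite_imageD) (auto simp: inj_on_def parts_inject)
qed

lemma bij_betw_quotient:
  assumes "l ` A = P"
  shows "\<exists>f. bij_betw f (A // {(x, y). x \<in> A \<and> y \<in> A \<and> l x = l y}) P"
proof -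
  let ?E = "{(x, y). x \<in> A \<and> y \<in> A \<and> l x = l y}" and ?f = "\<lambda>X. the_elem (l ` X)"
  have f: "?f (?E `` {x}) = l x" if "x \<in> A" for x
  proof -
    have "l ` (?E `` {x}) = {l x}" using that by force
    then show ?thesis by simp
  qed
  have "inj_on ?f (A // ?E)"
  proof (rule inj_onI)
    fix X Y
    assume "X \<in> A // ?E" "Y \<in> A // ?E" "?f X = ?f Y"
    then obtain x y where "X = ?E `` {x}" "x \<in> A" "Y = ?E `` {y}" "y \<in> A" "l x = l y"
      using f by (auto elim!: quotientE)
    then show "X = Y" by auto
  qed
  moreover have "?f ` (A // ?E) = P"
  proof -
    have "?f ` (A // ?E) = (\<lambda>x. ?f (?E `` {x})) ` A"
      by (auto simp: quotient_def)
    also have "\<dots> = l ` A"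
      by (rule image_cong) (simp_all only: f)
    finally show ?thesis using assms by simp
  qed
  ultimately show ?thesis
    unfolding bij_betw_def by blast
qed

text \<open>Lists instead of partitions because \<open>chi\<close> takes a list; passing to
  \<open>mset I\<close> later forgets the order.\<close>

definition character :: "nat \<Rightarrow> nat \<Rightarrow> nat list \<Rightarrow> bool"
  where "character n k I \<longleftrightarrow> 0 \<notin> set I \<and> sum_list I = n \<and> count (mset I) 1 \<le> k"

context
  fixes scale :: "complex \<Rightarrow> 'v \<Rightarrow> 'v::ab_group_add"
  assumes vector_space: "vector_space scale"
begin

interpretation vector_space scale
  by (rule vector_space)

text \<open>Among the sets \<open>U\<close> of compositions of \<open>n\<close> that are closed
  under passing to more parts, choose a largest one such that some nonzero \<open>w\<close> is
  annihilated by all elements of \<open>D n k\<close> supported in \<open>U\<close>. If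
  \<open>w\<close> were not an eigenvector, \<open>iprod_peel_off\<close> would yield a vector for a
  larger set. Only the finite set of compositions is exhausted, so \<open>V\<close> may have any
  dimension.\<close>

lemma exists_eigenvector:
  assumes rep: "Defs.representation scale n k V \<rho>" and V: "V \<noteq> {0}"
  shows "\<exists>I w. 0 \<notin> set I \<and> sum_list I = n \<and> w \<in> V \<and> w \<noteq> 0 \<and>
    (\<forall>F\<in>D n k. \<rho> F w = scale (chi I F) w)"
proof (rule ccontr)
  assume contra: "\<not> ?thesis"
  have sub: "subspace V"
    and in_V: "\<And>F v. F \<in> D n k \<Longrightarrow> v \<in> V \<Longrightarrow> \<rho> F v \<in> V"
    and add: "\<And>F v w. F \<in> D n k \<Longrightarrow> v \<in> V \<Longrightarrow> w \<in> V \<Longrightarrow> \<rho> F (v + w) = \<rho> F v + \<rho> F w"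
    and smult: "\<And>F c v. F \<in> D n k \<Longrightarrow> v \<in> V \<Longrightarrow> \<rho> F (scale c v) = scale c (\<rho> F v)"
    and add': "\<And>F G v. F \<in> D n k \<Longrightarrow> G \<in> D n k \<Longrightarrow> v \<in> V \<Longrightarrow> \<rho> (F + G) v = \<rho> F v + \<rho> G v"
    and smult': "\<And>F c v. F \<in> D n k \<Longrightarrow> v \<in> V \<Longrightarrow> \<rho> (smult_sym c F) v = scale c (\<rho> F v)"
    and mult: "\<And>F G v. F \<in> D n k \<Longrightarrow> G \<in> D n k \<Longrightarrow> v \<in> V \<Longrightarrow> \<rho> (iprod F G) v = \<rho> F (\<rho> G v)"
    and unit: "\<And>v. v \<in> V \<Longrightarrow> \<rho> (D_unit n k) v = v"
    using rep unfolding Defs.representation_def by blast+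
  let ?C = "{I. sum_list (parts I) = n}"
  define Q where "Q U \<longleftrightarrow> U \<subseteq> ?C \<and>
    (\<forall>J\<in>U. \<forall>K\<in>?C. length (parts J) < length (parts K) \<longrightarrow> K \<in> U) \<and>
    (\<exists>w\<in>V. w \<noteq> 0 \<and> (\<forall>F\<in>D n k. Poly_Mapping.keys F \<subseteq> U \<longrightarrow> \<rho> F w = 0))" for U
  obtain v where v: "v \<in> V" "v \<noteq> 0"
    using V subspace_0 [OF sub] by auto
  \<comment> \<open>Only the zero element has empty support, so this settles
    \<open>Q {}\<close>.\<close>
  have "\<rho> 0 v = 0"
    using smult' [OF sym.subspace_0 [OF subspace_D] v(1), of 0] by simp
  then have "Q {}"
    using v by (auto simp: Q_def)
  moreover have "\<forall>U. Q U \<longrightarrow> card U < Suc (card ?C)"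
    unfolding Q_def using card_mono [OF finite_compositions] by (simp add: less_Suc_eq_le)
  ultimately have "\<exists>U. Q U \<and> (\<forall>U'. Q U' \<longrightarrow> card U' \<le> card U)"
    by (rule ex_has_greatest_nat)
  then obtain U where U: "Q U" and max: "\<And>U'. Q U' \<Longrightarrow> card U' \<le> card U"
    by blast
  then obtain w where w: "w \<in> V" "w \<noteq> 0"
    and ann: "\<And>F. F \<in> D n k \<Longrightarrow> Poly_Mapping.keys F \<subseteq> U \<Longrightarrow> \<rho> F w = 0"
    unfolding Q_def by blast
  \<comment> \<open>Otherwise the unit would annihilate \<open>w\<close>.\<close>
  have "U \<noteq> ?C"
  proof
    assume "U = ?C"
    then have "Poly_Mapping.keys (D_unit n k) \<subseteq> U"
      using D_unit_in_D [of n k] D_subset_Sym_hom [of n k] by (auto simp: Sym_hom_def)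
    then show False
      using ann [OF D_unit_in_D] unit w by auto
  qed
  then have ne: "?C - U \<noteq> {}" and fin: "finite (?C - U)"
    using U finite_compositions by (auto simp: Q_def)
  \<comment> \<open>A composition outside \<open>U\<close> with the most parts, so that
    \<open>insert I U\<close> has the closure property again.\<close>
  then obtain I where I: "I \<in> ?C - U"
    and longest: "\<And>K. K \<in> ?C - U \<Longrightarrow> length (parts K) \<le> length (parts I)"
    using Max_in [of "(\<lambda>K. length (parts K)) ` (?C - U)"]
      Max_ge [of "(\<lambda>K. length (parts K)) ` (?C - U)"] by fastforce
  have up: "K \<in> U" if "J \<in> insert I U" "sum_list (parts K) = n" "length (parts J) < length (parts K)"
    for J K
  proof (rule ccontr)
    assume "K \<notin> U"
    with that(2) have "length (parts K) \<le> length (parts I)"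
      by (intro longest) simp
    with \<open>K \<notin> U\<close> show False
      using that U by (auto simp: Q_def)
  qed
  \<comment> \<open>Some \<open>G\<close> shows that \<open>w\<close> is not an eigenvector for
    \<open>chi (parts I)\<close>; the difference \<open>w'\<close> will replace \<open>w\<close> for
    the set \<open>insert I U\<close>.\<close>
  obtain G where G: "G \<in> D n k" "\<rho> G w \<noteq> scale (chi (parts I) G) w"
    using contra I w zero_notin_parts by blast
  define w' where "w' = \<rho> G w - scale (chi (parts I) G) w"
  have w'_V: "w' \<in> V"
    unfolding w'_def by (intro subspace_diff subspace_scale sub in_V G w)
  have "\<rho> F w' = 0" if F: "F \<in> D n k" "Poly_Mapping.keys F \<subseteq> insert I U" for F
  proof -
    let ?c = "chi (parts I) G"
    have FG: "iprod F G \<in> D n k" and cF: "smult_sym (- ?c) F \<in> D n k"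
      by (intro iprod_in_D sym.subspace_scale [OF subspace_D] F G)+
    have "\<rho> F w' = \<rho> F (\<rho> G w + scale (- ?c) w)"
      by (simp add: w'_def)
    also have "\<dots> = \<rho> (iprod F G) w + \<rho> (smult_sym (- ?c) F) w"
      using F G w in_V subspace_scale [OF sub] by (simp only: add smult mult smult')
    also have "\<dots> = \<rho> (iprod F G - smult_sym ?c F) w"
      using add' [OF FG cF w(1)] by simp
    also have "\<dots> = 0"
    proof (rule ann)
      show "iprod F G - smult_sym ?c F \<in> D n k"
        by (intro sym.subspace_diff [OF subspace_D] sym.subspace_scale [OF subspace_D] FG F)
      show "Poly_Mapping.keys (iprod F G - smult_sym ?c F) \<subseteq> U"
        using F D_subset_Sym_hom by (intro iprod_peel_off [OF up _ _ G(1)]) auto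
    qed
    finally show ?thesis .
  qed
  moreover have "w' \<noteq> 0"
    using G by (simp add: w'_def)
  ultimately have "\<exists>w\<in>V. w \<noteq> 0 \<and>
      (\<forall>F\<in>D n k. Poly_Mapping.keys F \<subseteq> insert I U \<longrightarrow> \<rho> F w = 0)"
    using w'_V by blast
  moreover have "insert I U \<subseteq> ?C"
    using U I by (simp add: Q_def)
  ultimately have "Q (insert I U)"
    unfolding Q_def using up by blast
  then have "card (insert I U) \<le> card U"
    by (rule max)
  then show False
    using I U finite_subset [OF _ finite_compositions, of U n] by (simp add: Q_def)
qed

text \<open>The line through a common eigenvector is invariant, hence the whole space. With more
  than \<open>k\<close> ones in \<open>I\<close> the unit would act as 0 by
  \<open>chi_eq_0\<close>.\<close>

lemma irreducible_repD:
  assumes "irreducible_rep scale n k V \<rho>"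
  shows "\<exists>I w. character n k I \<and> w \<noteq> 0 \<and> V = span {w} \<and>
    (\<forall>F\<in>D n k. \<forall>v\<in>V. \<rho> F v = scale (chi I F) v)"
proof -
  have rep: "Defs.representation scale n k V \<rho>" and V: "V \<noteq> {0}"
    and irr: "\<And>U. subspace U \<Longrightarrow> U \<subseteq> V \<Longrightarrow> (\<forall>F\<in>D n k. \<forall>u\<in>U. \<rho> F u \<in> U) \<Longrightarrow> U = {0} \<or> U = V"
    using assms unfolding irreducible_rep_def by blast+
  obtain I w where I: "0 \<notin> set I" "sum_list I = n" and w: "w \<in> V" "w \<noteq> 0"
    and eig: "\<And>F. F \<in> D n k \<Longrightarrow> \<rho> F w = scale (chi I F) w"
    using exists_eigenvector [OF rep V] by blast
  have sub: "subspace V"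
    and smult: "\<And>F c v. F \<in> D n k \<Longrightarrow> v \<in> V \<Longrightarrow> \<rho> F (scale c v) = scale c (\<rho> F v)"
    and unit: "\<And>v. v \<in> V \<Longrightarrow> \<rho> (D_unit n k) v = v"
    using rep unfolding Defs.representation_def by blast+
  have act: "\<rho> F v = scale (chi I F) v" if "F \<in> D n k" "v \<in> span {w}" for F v
    using that w by (auto simp: span_singleton smult eig mult.commute)
  have "span {w} = {0} \<or> span {w} = V"
  proof (rule irr)
    show "span {w} \<subseteq> V"
      using w sub by (simp add: span_minimal)
    show "\<forall>F\<in>D n k. \<forall>u\<in>span {w}. \<rho> F u \<in> span {w}"
      by (simp add: act span_scale)
  qed (rule subspace_span)
  then have "V = span {w}"
    using w span_base [of w "{w}"] by auto
  moreover have "count (mset I) 1 \<le> k"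
  proof (rule ccontr)
    assume "\<not> ?thesis"
    then have "chi I (D_unit n k) = 0"
      by (intro chi_eq_0 [OF I _ D_unit_in_D]) simp
    then show False
      using eig [OF D_unit_in_D] unit w by simp
  qed
  ultimately show ?thesis
    using I w act unfolding character_def by blast
qed

lemma irreducible_rep_chi:
  assumes I: "character n k I" and w: "w \<noteq> 0"
  shows "irreducible_rep scale n k (span {w}) (\<lambda>F v. scale (chi I F) v)"
proof -
  have "chi I (iprod F G) = chi I F * chi I G" if "F \<in> D n k" "G \<in> D n k" for F G
    using that I D_subset_Sym_hom by (intro chi_iprod [of I n]) (auto simp: character_def)
  moreover have "chi I (D_unit n k) = 1"
    using I by (intro chi_D_unit) (auto simp: character_def)
  ultimately have "Defs.representation scale n k (span {w}) (\<lambda>F v. scale (chi I F) v)"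
    unfolding Defs.representation_def
    by (auto simp: span_scale scale_right_distrib scale_left_distrib chi_linear mult.commute)
  moreover have "span {w} \<noteq> {0}"
    using w span_base [of w "{w}"] by auto
  moreover have "U = {0} \<or> U = span {w}" if U: "subspace U" "U \<subseteq> span {w}" for U
  proof (rule disjCI)
    assume "U \<noteq> span {w}"
    have False if u: "u \<in> U" "u \<noteq> 0" for u
    proof -
      obtain c where c: "u = scale c w" "c \<noteq> 0"
        using u U by (auto simp: span_singleton)
      then have "w \<in> U"
        using subspace_scale [OF U(1) u(1), of "1 / c"] by simp
      then show False
        using U \<open>U \<noteq> span {w}\<close> by (simp add: span_minimal subset_antisym)
    qed
    then show "U = {0}"
      using subspace_0 [OF U(1)] by blast
  qed
  ultimately show ?thesis
    unfolding irreducible_rep_def by blast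
qed

text \<open>A relation at first: the list \<open>I\<close> is not determined by the representation.
  Its multiset is, since the characters of different partitions differ on
  \<open>D n k\<close>.\<close>

definition has_label :: "nat \<Rightarrow> nat \<Rightarrow> 'v set \<times> (sym \<Rightarrow> 'v \<Rightarrow> 'v) \<Rightarrow> nat multiset \<Rightarrow> bool"
  where "has_label n k R p \<longleftrightarrow> (\<exists>I. character n k I \<and> p = mset I \<and>
    (\<forall>F\<in>D n k. \<forall>v\<in>fst R. snd R F v = scale (chi I F) v))"

lemma character_eqI:
  assumes "character n k I" "character n k J"
    and "\<And>F. F \<in> D n k \<Longrightarrow> scale (chi I F) w = scale (chi J F) w" "w \<noteq> 0"
  shows "mset I = mset J"
  using assms by (intro chi_separates [of I n k J]) (auto simp: character_def)

lemma irreps_line: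
  assumes "R \<in> irreps scale n k"
  obtains w where "w \<noteq> 0" "fst R = span {w}"
  using assms irreducible_repD by (fastforce simp: irreps_def)

lemma ex1_label:
  assumes R: "R \<in> irreps scale n k"
  shows "\<exists>!p. has_label n k R p"
proof (rule ex_ex1I)
  show "\<exists>p. has_label n k R p"
    using R irreducible_repD [of n k "fst R" "snd R"] by (auto simp: irreps_def has_label_def)
  fix p q
  assume "has_label n k R p" "has_label n k R q"
  then obtain I J where I: "character n k I" "p = mset I" and J: "character n k J" "q = mset J"
    and act: "\<And>F v. F \<in> D n k \<Longrightarrow> v \<in> fst R \<Longrightarrow> snd R F v = scale (chi I F) v"
      "\<And>F v. F \<in> D n k \<Longrightarrow> v \<in> fst R \<Longrightarrow> snd R F v = scale (chi J F) v"
    unfolding has_label_def by blast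
  obtain w where w: "w \<noteq> 0" "fst R = span {w}"
    using R by (rule irreps_line)
  then have "w \<in> fst R"
    by (simp add: span_base)
  then have "scale (chi I F) w = scale (chi J F) w" if "F \<in> D n k" for F
    using act that by metis
  then show "p = q"
    using character_eqI [OF I(1) J(1) _ w(1)] I J by simp
qed

lemma rep_isomorphic_iff:
  assumes R: "R \<in> irreps scale n k" "has_label n k R p" and T: "T \<in> irreps scale n k" "has_label n k T q"
  shows "rep_isomorphic scale n k R T \<longleftrightarrow> p = q"
proof -
  obtain V \<rho> W \<sigma> where RT: "R = (V, \<rho>)" "T = (W, \<sigma>)"
    by (metis surj_pair)
  obtain I where I: "character n k I" "p = mset I"
    and \<rho>: "\<And>F v. F \<in> D n k \<Longrightarrow> v \<in> V \<Longrightarrow> \<rho> F v = scale (chi I F) v"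
    using R(2) unfolding has_label_def RT by auto
  obtain J where J: "character n k J" "q = mset J"
    and \<sigma>: "\<And>F v. F \<in> D n k \<Longrightarrow> v \<in> W \<Longrightarrow> \<sigma> F v = scale (chi J F) v"
    using T(2) unfolding has_label_def RT by auto
  obtain w where w: "w \<noteq> 0" "V = span {w}"
    using irreps_line [OF R(1)] RT by auto
  obtain w' where w': "w' \<noteq> 0" "W = span {w'}"
    using irreps_line [OF T(1)] RT by auto
  show ?thesis
  proof
    assume "rep_isomorphic scale n k R T"
    then obtain \<phi> where bij: "bij_betw \<phi> V W"
      and smult: "\<And>c v. v \<in> V \<Longrightarrow> \<phi> (scale c v) = scale c (\<phi> v)"
      and hom: "\<And>F v. F \<in> D n k \<Longrightarrow> v \<in> V \<Longrightarrow> \<phi> (\<rho> F v) = \<sigma> F (\<phi> v)"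
      unfolding rep_isomorphic_def RT by auto
    have "w' \<in> W"
      using w' by (simp add: span_base)
    then obtain v where v: "v \<in> V" "\<phi> v = w'"
      using bij by (auto simp: bij_betw_def)
    have "scale (chi I F) w' = scale (chi J F) w'" if "F \<in> D n k" for F
      using hom [OF that v(1)] \<rho> [OF that v(1)] \<sigma> [OF that \<open>w' \<in> W\<close>] smult [OF v(1)] v(2) by simp
    then show "p = q"
      using character_eqI [OF I(1) J(1) _ w'(1)] I J by simp
  next
    assume "p = q"
    then have eq: "chi I F = chi J F" if "F \<in> D n k" for F
      using that I J by (intro chi_cong_mset [of I n J F k]) (auto simp: character_def)
    \<comment> \<open>The coordinate along \<open>w\<close>, well defined on the line
      \<open>V\<close> because \<open>w \<noteq> 0\<close>. So \<phi> is the linear map that sends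
      \<open>w\<close> to \<open>w'\<close>.\<close>
    define c where "c v = (THE a. v = scale a w)" for v
    have c: "c (scale a w) = a" for a
      unfolding c_def using w(1) by auto
    define \<phi> where "\<phi> v = scale (c v) w'" for v
    have \<phi>: "\<phi> (scale a w) = scale a w'" for a
      by (simp add: \<phi>_def c)
    have V: "V = range (\<lambda>a. scale a w)" and W: "W = range (\<lambda>a. scale a w')"
      using w w' by (simp_all add: span_singleton)
    have "bij_betw \<phi> V W"
      unfolding bij_betw_def V W using w'(1) by (auto simp: inj_on_def \<phi> image_image)
    moreover have "\<phi> (u + v) = \<phi> u + \<phi> v" if "u \<in> V" "v \<in> V" for u v
      using that unfolding V by (auto simp: \<phi> simp flip: scale_left_distrib)
    moreover have "\<phi> (scale a v) = scale a (\<phi> v)" if "v \<in> V" for a v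
      using that unfolding V by (auto simp: \<phi>)
    moreover from this have "\<phi> (\<rho> F v) = \<sigma> F (\<phi> v)" if "F \<in> D n k" "v \<in> V" for F v
    proof -
      have "\<phi> v \<in> W"
        using that unfolding V W by (auto simp: \<phi>)
      then show ?thesis
        using that by (simp add: \<rho> \<sigma> eq \<open>\<And>v a. v \<in> V \<Longrightarrow> \<phi> (scale a v) = scale a (\<phi> v)\<close>)
    qed
    ultimately show "rep_isomorphic scale n k R T"
      unfolding rep_isomorphic_def RT by auto
  qed
qed

text \<open>Isomorphism is equality of labels, so the classes are the fibres of the labelling. Every
  partition occurs, realized by its character on the line through any nonzero vector.\<close>

lemma irreps_bij_partitions:
  assumes nontrivial: "\<exists>v :: 'v. v \<noteq> 0"
  shows "\<exists>f. bij_betw f (irreps scale n k // irrep_iso scale n k) (partitions_few_ones n k)"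
proof -
  define label where "label R = (THE p. has_label n k R p)" for R
  have label: "has_label n k R p \<longleftrightarrow> label R = p" if "R \<in> irreps scale n k" for R p
    unfolding label_def using theI' [OF ex1_label [OF that]] ex1_label [OF that] by blast
  have iso: "irrep_iso scale n k =
      {(R, T). R \<in> irreps scale n k \<and> T \<in> irreps scale n k \<and> label R = label T}"
    unfolding irrep_iso_def using rep_isomorphic_iff label by blast
  have image: "label ` irreps scale n k = partitions_few_ones n k"
  proof (intro set_eqI iffI)
    fix p
    assume "p \<in> label ` irreps scale n k"
    then obtain R where "has_label n k R p"
      using label by blast
    then show "p \<in> partitions_few_ones n k"
      by (auto simp: has_label_def character_def partitions_few_ones_def sum_mset_sum_list)
  next
    fix p
    assume "p \<in> partitions_few_ones n k"
    moreover obtain I where I: "p = mset I"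
      by (metis ex_mset)
    ultimately have "character n k I"
      by (simp add: partitions_few_ones_def character_def sum_mset_sum_list)
    moreover obtain w :: 'v where "w \<noteq> 0"
      using nontrivial by blast
    ultimately have R: "(span {w}, \<lambda>F v. scale (chi I F) v) \<in> irreps scale n k"
      and "has_label n k (span {w}, \<lambda>F v. scale (chi I F) v) p"
      using irreducible_rep_chi I by (auto simp: irreps_def has_label_def)
    then show "p \<in> label ` irreps scale n k"
      using label [OF R] R by (metis image_eqI)
  qed
  show ?thesis
    unfolding iso by (rule bij_betw_quotient [OF image])
qed

lemma dim_irreducible_rep:
  assumes "irreducible_rep scale n k V \<rho>"
  shows "dim V = 1"
proof -
  obtain w where "w \<noteq> 0" "V = span {w}"
    using irreducible_repD [OF assms] by blast
  then show ?thesis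
    by (simp add: dim_eq_card_independent dim_span)
qed

end

theorem corollary2p14:
  fixes n k :: nat
    and scale :: "complex \<Rightarrow> 'v \<Rightarrow> 'v::ab_group_add"
  assumes "vector_space scale"
    and nontrivial: "\<exists>v :: 'v. v \<noteq> 0"
  shows "(\<forall>V \<rho>. irreducible_rep scale n k V \<rho> \<longrightarrow> vector_space.dim scale V = 1) \<and>
    (\<exists>f. bij_betw f (irreps scale n k // irrep_iso scale n k) (partitions_few_ones n k))"
  using dim_irreducible_rep [OF assms(1)] irreps_bij_partitions [OF assms(1) nontrivial] by blast

end
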